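(* Fix an integer $K\ge 1$ and let $\Gamma(K)=1-\left(1-\frac{1}{K}\right)^K$. In the $K$-stage fractional configuration allocation problem, the algorithm PR-MCA described in the context is $\Gamma(K)$-competitive: for every instance, its revenue $\sum_{j\in V}\sum_{\tau\in[T]}\hat w_\tau\,\eta^{(K)}_{j,\tau}$ is at least $\Gamma(K)$ times the optimal value of the offline linear program defined in the context.
   Context: Multi-stage configuration allocation with free disposal: a finite set $V$ of advertisers, each demanding (normalized) $1$ unit of impressions; a finite set $C$ of configurations; users $U$ arriving in $K$ stages as disjoint nonempty batches $U_1,\dots,U_K$. For $i\in U,c\in C,j\in V$ there are $a_{i,c,j}\ge 0$ (impressions for $j$ if $i$ gets configuration $c$) and a per-impression price $w_{i,c,j}\ge 0$; these are revealed for $i\in U_k$ when batch $k$ arrives. There is a finite set of price levels $0=\hat w_0<\hat w_1<\dots<\hat w_T$ with every $w_{i,c,j}\in\{\hat w_0,\dots,\hat w_T\}$. The offline benchmark is the optimal value of the LP: maximize $\sum_{i,c,j}w_{i,c,j}x_{i,c,j}$ over $x,z\ge 0$ subject to $\sum_{i\in U}\sum_{c}x_{i,c,j}\le 1$ ($j\in V$), $\sum_c z_{i,c}\le 1$ ($i\in U$), $x_{i,c,j}\le a_{i,c,j}z_{i,c}$ (all $i,c,j$). Regularizers: for $k\in[K-1]$, $f_k(x)=\left(1-\frac{1-x}{K-k}\right)^{K-k}$, $f_K(x)=\mathbb{I}\{x=1\}$, $F_k(x)=\int_0^xf_k(t)dt$ (so $F_K\equiv0$). Stage program $P_k$ (given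 $\eta^{(k-1)}=(\eta^{(k-1)}_{j,\tau})_{j\in V,\tau\in[T]}$): variables $x=(x_{i,c,j})_{i\in U_k,c\in C,j\in V}$, $y=(y_{j,\tau})_{j\in V,\tau\in[T]}$, $z=(z_{i,c})_{i\in U_k,c\in C}$, all $\ge 0$. With $H_{j,\tau}(x,y)=\sum_{i\in U_k,c\in C:\,w_{i,c,j}\ge\hat w_\tau}x_{i,c,j}+\sum_{\tau'\ge\tau}y_{j,\tau'}$, maximize $\sum_{i\in U_k}\sum_c\sum_j w_{i,c,j}x_{i,c,j}-\sum_j\sum_{\tau\in[T]}\hat w_\tau(\eta^{(k-1)}_{j,\tau}-y_{j,\tau})-\sum_j\sum_{\tau\in[T]}(\hat w_\tau-\hat w_{\tau-1})F_k(H_{j,\tau}(x,y))$ subject to $\sum_{i\in U_k}\sum_c x_{i,c,j}+\sum_{\tau}y_{j,\tau}\le 1$ ($j\in V$), $\sum_c z_{i,c}\le 1$ ($i\in U_k$), $x_{i,c,j}\le a_{i,c,j}z_{i,c}$ ($i\in U_k,c,j$), $y_{j,\tau}\le\eta^{(k-1)}_{j,\tau}$ ($j,\tau$). Algorithm PR-MCA: $\eta^{(0)}=0$. For $k=1,\dots,K$: compute an optimal solution $(x^{(k)},y^{(k)},z^{(k)})$ of $P_k$; $z^{(k)}$ is the configuration allocation of batch $k$, $\eta^{(k-1)}-y^{(k)}$ the disposed impressions; set $\eta^{(k)}_{j,\tau}=\sum_{i\in U_k,c:\,w_{i,c,j}=\hat w_\tau}x^{(k)}_{i,c,j}+y^{(k)}_{j,\tau}$.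 The algorithm's revenue is $\sum_j\sum_{\tau\in[T]}\hat w_\tau\eta^{(K)}_{j,\tau}$ (equivalently $\sum_k[\sum w_{i,c,j}x^{(k)}_{i,c,j}-\sum_{j,\tau}\hat w_\tau(\eta^{(k-1)}_{j,\tau}-y^{(k)}_{j,\tau})]$). *)

theory Defs
  imports "HOL-Analysis.Analysis"
begin

text \<open>Multi-stage configuration allocation with free disposal.  Every advertiser's demand is
  normalised to one unit of impressions.  All families below are total functions; only their values
  on the index sets of the instance (batches \<open>1..K\<close>, configurations, advertisers, price
  levels \<open>0..T\<close>) matter.  The number \<open>K\<close> of stages is a separate parameter.\<close>

record ('u, 'c, 'v) mca =
  advertisers :: "'v set"
  configs :: "'c set"
  batch :: "nat \<Rightarrow> 'u set"
  imps :: "'u \<Rightarrow> 'c \<Rightarrow> 'v \<Rightarrow> real"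
  price :: "'u \<Rightarrow> 'c \<Rightarrow> 'v \<Rightarrow> real"
  top_level :: nat
  level :: "nat \<Rightarrow> real"

definition users :: "nat \<Rightarrow> ('u, 'c, 'v) mca \<Rightarrow> 'u set" where
  "users K I = (\<Union>k\<in>{1..K}. batch I k)"

definition mca_instance :: "nat \<Rightarrow> ('u, 'c, 'v) mca \<Rightarrow> bool" where
  "mca_instance K I \<longleftrightarrow>
     finite (advertisers I) \<and> finite (configs I) \<and>
     (\<forall>k\<in>{1..K}. finite (batch I k) \<and> batch I k \<noteq> {}) \<and>
     disjoint_family_on (batch I) {1..K} \<and>
     level I 0 = 0 \<and> strict_mono_on {0..top_level I} (level I) \<and>
     (\<forall>i\<in>users K I. \<forall>c\<in>configs I. \<forall>j\<in>advertisers I.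
        imps I i c j \<ge> 0 \<and> price I i c j \<in> level I ` {0..top_level I})"

section \<open>The offline linear program\<close>

definition offline_feasible ::
  "nat \<Rightarrow> ('u, 'c, 'v) mca \<Rightarrow> ('u \<Rightarrow> 'c \<Rightarrow> 'v \<Rightarrow> real) \<Rightarrow> ('u \<Rightarrow> 'c \<Rightarrow> real) \<Rightarrow> bool" where
  "offline_feasible K I x z \<longleftrightarrow>
     (\<forall>i\<in>users K I. \<forall>c\<in>configs I. \<forall>j\<in>advertisers I. 0 \<le> x i c j) \<and>
     (\<forall>i\<in>users K I. \<forall>c\<in>configs I. 0 \<le> z i c) \<and>
     (\<forall>j\<in>advertisers I. (\<Sum>i\<in>users K I. \<Sum>c\<in>configs I. x i c j) \<le> 1) \<and>
     (\<forall>i\<in>users K I. (\<Sum>c\<in>configs I. z i c) \<le> 1) \<and>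
     (\<forall>i\<in>users K I. \<forall>c\<in>configs I. \<forall>j\<in>advertisers I. x i c j \<le> imps I i c j * z i c)"

definition offline_value ::
  "nat \<Rightarrow> ('u, 'c, 'v) mca \<Rightarrow> ('u \<Rightarrow> 'c \<Rightarrow> 'v \<Rightarrow> real) \<Rightarrow> real" where
  "offline_value K I x =
     (\<Sum>i\<in>users K I. \<Sum>c\<in>configs I. \<Sum>j\<in>advertisers I. price I i c j * x i c j)"

definition offline_opt :: "nat \<Rightarrow> ('u, 'c, 'v) mca \<Rightarrow> real" where
  "offline_opt K I = Sup {offline_value K I x | x z. offline_feasible K I x z}"

text \<open>The supremum is over a nonempty set that is bounded above, so it is not a junk value.\<close>

lemma offline_values_nonempty: "{offline_value K I x | x z. offline_feasible K I x z} \<noteq> {}"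
  if "mca_instance K I"
proof -
  have "offline_feasible K I (\<lambda>_ _ _. 0) (\<lambda>_ _. 0)"
    by (simp add: offline_feasible_def)
  then show ?thesis by blast
qed

lemma offline_values_bdd_above: "bdd_above {offline_value K I x | x z. offline_feasible K I x z}"
  if inst: "mca_instance K I"
proof (rule bdd_aboveI)
  fix v assume "v \<in> {offline_value K I x | x z. offline_feasible K I x z}"
  then obtain x z where v: "v = offline_value K I x" and feas: "offline_feasible K I x z"
    by blast
  have fin: "finite (configs I)" using inst by (simp add: mca_instance_def)
  have "price I i c j * x i c j \<le> price I i c j * imps I i c j"
    if i: "i \<in> users K I" and c: "c \<in> configs I" and j: "j \<in> advertisers I" for i c j
  proof -
    have "z i c \<le> (\<Sum>c\<in>configs I. z i c)"
      using feas i c fin by (intro member_le_sum) (auto simp: offline_feasible_def)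
    also have "\<dots> \<le> 1" using feas i by (simp add: offline_feasible_def)
    finally have z1: "z i c \<le> 1" .
    have a: "imps I i c j \<ge> 0" and p: "price I i c j \<in> level I ` {0..top_level I}"
      using inst i c j by (auto simp: mca_instance_def)
    have "x i c j \<le> imps I i c j * z i c"
      using feas i c j by (simp add: offline_feasible_def)
    also have "\<dots> \<le> imps I i c j" using z1 a by (simp add: mult_left_le)
    finally have x: "x i c j \<le> imps I i c j" .
    obtain t where t: "t \<le> top_level I" "price I i c j = level I t" using p by auto
    have "level I 0 \<le> level I t"
      using inst t strict_mono_on_leD[of "{0..top_level I}" "level I" 0 t]
      by (simp add: mca_instance_def)
    then have "price I i c j \<ge> 0" using t inst by (simp add: mca_instance_def)
    then show ?thesis using x by (rule mult_left_mono[rotated])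
  qed
  then show "v \<le> offline_value K I (imps I)"
    unfolding v offline_value_def by (intro sum_mono)
qed

section \<open>Regularizers\<close>

definition reg_f :: "nat \<Rightarrow> nat \<Rightarrow> real \<Rightarrow> real" where
  "reg_f K k x =
     (if k < K then (1 - (1 - x) / real (K - k)) ^ (K - k) else if x = 1 then 1 else 0)"

definition reg_F :: "nat \<Rightarrow> nat \<Rightarrow> real \<Rightarrow> real" where
  "reg_F K k x = integral {0..x} (reg_f K k)"

section \<open>The stage program\<close>

text \<open>The carried-over allocation \<open>\<eta>\<close> and the retained part \<open>y\<close> are indexed by advertiser and by a price level
  \<open>\<tau> \<in> {1..T}\<close>.\<close>

definition stage_H ::
  "('u, 'c, 'v) mca \<Rightarrow> nat \<Rightarrow> ('u \<Rightarrow> 'c \<Rightarrow> 'v \<Rightarrow> real) \<Rightarrow> ('v \<Rightarrow> nat \<Rightarrow> real) \<Rightarrow> 'v \<Rightarrow> nat \<Rightarrow> real" where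
  "stage_H I k x y j \<tau> =
     (\<Sum>(i, c) \<in> {(i, c). i \<in> batch I k \<and> c \<in> configs I \<and> price I i c j \<ge> level I \<tau>}. x i c j)
     + (\<Sum>\<tau>'\<in>{\<tau>..top_level I}. y j \<tau>')"

definition stage_feasible ::
  "('u, 'c, 'v) mca \<Rightarrow> nat \<Rightarrow> ('v \<Rightarrow> nat \<Rightarrow> real) \<Rightarrow>
     ('u \<Rightarrow> 'c \<Rightarrow> 'v \<Rightarrow> real) \<Rightarrow> ('v \<Rightarrow> nat \<Rightarrow> real) \<Rightarrow> ('u \<Rightarrow> 'c \<Rightarrow> real) \<Rightarrow> bool" where
  "stage_feasible I k \<eta> x y z \<longleftrightarrow>
     (\<forall>i\<in>batch I k. \<forall>c\<in>configs I. \<forall>j\<in>advertisers I. 0 \<le> x i c j) \<and>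
     (\<forall>j\<in>advertisers I. \<forall>\<tau>\<in>{1..top_level I}. 0 \<le> y j \<tau>) \<and>
     (\<forall>i\<in>batch I k. \<forall>c\<in>configs I. 0 \<le> z i c) \<and>
     (\<forall>j\<in>advertisers I.
        (\<Sum>i\<in>batch I k. \<Sum>c\<in>configs I. x i c j) + (\<Sum>\<tau>\<in>{1..top_level I}. y j \<tau>) \<le> 1) \<and>
     (\<forall>i\<in>batch I k. (\<Sum>c\<in>configs I. z i c) \<le> 1) \<and>
     (\<forall>i\<in>batch I k. \<forall>c\<in>configs I. \<forall>j\<in>advertisers I. x i c j \<le> imps I i c j * z i c) \<and>
     (\<forall>j\<in>advertisers I. \<forall>\<tau>\<in>{1..top_level I}. y j \<tau> \<le> \<eta> j \<tau>)"

definition stage_objective ::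
  "nat \<Rightarrow> ('u, 'c, 'v) mca \<Rightarrow> nat \<Rightarrow> ('v \<Rightarrow> nat \<Rightarrow> real) \<Rightarrow>
     ('u \<Rightarrow> 'c \<Rightarrow> 'v \<Rightarrow> real) \<Rightarrow> ('v \<Rightarrow> nat \<Rightarrow> real) \<Rightarrow> real" where
  "stage_objective K I k \<eta> x y =
     (\<Sum>i\<in>batch I k. \<Sum>c\<in>configs I. \<Sum>j\<in>advertisers I. price I i c j * x i c j)
     - (\<Sum>j\<in>advertisers I. \<Sum>\<tau>\<in>{1..top_level I}. level I \<tau> * (\<eta> j \<tau> - y j \<tau>))
     - (\<Sum>j\<in>advertisers I. \<Sum>\<tau>\<in>{1..top_level I}.
          (level I \<tau> - level I (\<tau> - 1)) * reg_F K k (stage_H I k x y j \<tau>))"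

definition stage_optimal ::
  "nat \<Rightarrow> ('u, 'c, 'v) mca \<Rightarrow> nat \<Rightarrow> ('v \<Rightarrow> nat \<Rightarrow> real) \<Rightarrow>
     ('u \<Rightarrow> 'c \<Rightarrow> 'v \<Rightarrow> real) \<Rightarrow> ('v \<Rightarrow> nat \<Rightarrow> real) \<Rightarrow> ('u \<Rightarrow> 'c \<Rightarrow> real) \<Rightarrow> bool" where
  "stage_optimal K I k \<eta> x y z \<longleftrightarrow>
     stage_feasible I k \<eta> x y z \<and>
     (\<forall>x' y' z'. stage_feasible I k \<eta> x' y' z' \<longrightarrow>
        stage_objective K I k \<eta> x' y' \<le> stage_objective K I k \<eta> x y)"

section \<open>The algorithm\<close>

text \<open>The algorithm may pick any optimal solution of each stage program, so it is modelled as a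
  predicate on its possible executions; \<open>x k\<close>, \<open>y k\<close>, \<open>z k\<close> are the solution of stage
  \<open>k\<close> and \<open>\<eta> k\<close> is the state after it.\<close>

definition pr_mca_run ::
  "nat \<Rightarrow> ('u, 'c, 'v) mca \<Rightarrow> (nat \<Rightarrow> 'u \<Rightarrow> 'c \<Rightarrow> 'v \<Rightarrow> real) \<Rightarrow> (nat \<Rightarrow> 'v \<Rightarrow> nat \<Rightarrow> real) \<Rightarrow>
     (nat \<Rightarrow> 'u \<Rightarrow> 'c \<Rightarrow> real) \<Rightarrow> (nat \<Rightarrow> 'v \<Rightarrow> nat \<Rightarrow> real) \<Rightarrow> bool" where
  "pr_mca_run K I x y z \<eta> \<longleftrightarrow>
     (\<forall>j\<in>advertisers I. \<forall>\<tau>\<in>{1..top_level I}. \<eta> 0 j \<tau> = 0) \<and>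
     (\<forall>k\<in>{1..K}.
        stage_optimal K I k (\<eta> (k - 1)) (x k) (y k) (z k) \<and>
        (\<forall>j\<in>advertisers I. \<forall>\<tau>\<in>{1..top_level I}.
           \<eta> k j \<tau> =
             (\<Sum>(i, c) \<in> {(i, c). i \<in> batch I k \<and> c \<in> configs I \<and> price I i c j = level I \<tau>}.
                x k i c j) + y k j \<tau>))"

definition revenue :: "nat \<Rightarrow> ('u, 'c, 'v) mca \<Rightarrow> (nat \<Rightarrow> 'v \<Rightarrow> nat \<Rightarrow> real) \<Rightarrow> real" where
  "revenue K I \<eta> = (\<Sum>j\<in>advertisers I. \<Sum>\<tau>\<in>{1..top_level I}. level I \<tau> * \<eta> K j \<tau>)"

definition Gamma_ratio :: "nat \<Rightarrow> real" where
  "Gamma_ratio K = 1 - (1 - 1 / real K) ^ K"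

end

theory Submission
  imports Defs
begin

text \<open>Summing by parts over the price levels turns the objective of a stage into
  \<open>\<Sum>\<^sub>j\<^sub>,\<^sub>\<tau> (w\<^sub>\<tau> - w\<^sub>\<tau>\<^sub>-\<^sub>1) (H - F\<^sub>k(H))\<close> up to a constant.  Linearise it at the stage optimum and price the capacities by
  multipliers \<open>\<theta>\<^sub>j\<close>.  The truncated marginals \<open>max (D - \<theta>\<^sub>j) 0\<close> have normalised increments
  \<open>a \<in> [0, 1 - f\<^sub>k(H)]\<close> over the levels, with equality and with no decrease of \<open>H\<close> wherever \<open>H < 1\<close>.
  Testing the stage optimum against the offline allocation of the batch, with everything retained
  from the previous stage, bounds the \<open>a\<close>-weighted offline allocation by the \<open>a\<close>-weighted growth of
  \<open>H\<close>.  What is left is an inequality at a single advertiser and level, which telescopes because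
  \<open>(1 - (h' - h)) f\<^sub>k\<^sub>+\<^sub>1(h') \<le> f\<^sub>k(h)\<close> by the weighted arithmetic-geometric mean inequality.\<close>

section \<open>Regularizers\<close>

text \<open>Bernoulli's inequality with exponent \<open>Suc m\<close>, after a power of
  \<open>b\<close> is scaled out. This is AM-GM for one factor \<open>a\<close> and \<open>m\<close>
  factors \<open>b\<close>.\<close>

lemma mult_power_le_power_weighted_mean:
  fixes a b :: real
  assumes "0 \<le> a" "0 \<le> b" "m \<ge> 1"
  shows "a * b ^ m \<le> ((a + real m * b) / real (Suc m)) ^ Suc m"
proof (cases "b = 0")
  case True
  then show ?thesis using assms by (simp add: power_0_left)
next
  case False
  then have b: "b > 0" using assms by simp
  \<comment> \<open>\<open>t\<close> is chosen so that \<open>a / b = 1 + real (Suc m) * t\<close>,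
    while the weighted mean becomes \<open>b * (1 + t)\<close>.\<close>
  define t where "t = (a - b) / (real (Suc m) * b)"
  have "t = a / (real (Suc m) * b) - 1 / real (Suc m)"
    using b by (simp add: t_def diff_divide_distrib)
  moreover have "1 / real (Suc m) \<le> 1" "0 \<le> a / (real (Suc m) * b)" using assms by auto
  ultimately have t: "-1 \<le> t" by linarith
  have "a * b ^ m = b ^ Suc m * (1 + real (Suc m) * t)"
  proof -
    have "1 + real (Suc m) * t = a / b"
      using b by (simp add: t_def field_simps del: of_nat_Suc)
    then show ?thesis using b by simp
  qed
  also have "\<dots> \<le> b ^ Suc m * (1 + t) ^ Suc m"
    using b Bernoulli_inequality[OF t, of "Suc m"] by (intro mult_left_mono) auto
  also have "\<dots> = (b * (1 + t)) ^ Suc m" by (simp only: power_mult_distrib)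
  also have "b * (1 + t) = (a + real m * b) / real (Suc m)"
  proof -
    have "b * (1 + t) = (a + (n - 1) * b) / n" if "n = real (Suc m)" "n > 0" for n
      using b that(2) unfolding t_def that(1)[symmetric] by (simp add: field_simps)
    from this[OF refl] show ?thesis by simp
  qed
  finally show ?thesis .
qed

section \<open>Bounds and the one-stage recursion of the regularizers\<close>

lemma reg_f_one: "reg_f K k 1 = 1"
  by (simp add: reg_f_def)

lemma reg_f_nonneg:
  assumes "0 \<le> x"
  shows "0 \<le> reg_f K k x"
proof (cases "k < K")
  case True
  then have "(1 - x) / real (K - k) \<le> 1" using assms by (simp add: divide_le_eq)
  then show ?thesis using True by (simp add: reg_f_def)
qed (simp add: reg_f_def)

lemma reg_f_less_one:
  assumes "0 \<le> x" "x < 1"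
  shows "reg_f K k x < 1"
proof (cases "k < K")
  case True
  then have "(1 - x) / real (K - k) \<le> 1" "0 < (1 - x) / real (K - k)"
    using assms by (auto simp: divide_le_eq)
  then have "(1 - (1 - x) / real (K - k)) ^ (K - k) < 1 ^ (K - k)"
    using True by (intro power_strict_mono) auto
  then show ?thesis using True by (simp add: reg_f_def)
qed (use assms in \<open>simp add: reg_f_def\<close>)

text \<open>The mean of \<open>1 - (h' - h)\<close> and \<open>m\<close> copies of the base of
  \<open>reg_f K (Suc k) h'\<close> is exactly the base of \<open>reg_f K k h\<close>, so weighted
  AM-GM applies. If \<open>Suc k = K\<close>, the left side vanishes unless \<open>h' = 1\<close>,
  and then both sides equal \<open>h\<close>.\<close>

lemma reg_f_step:
  assumes k: "Suc k \<le> K" and h: "0 \<le> h" "0 \<le> h'" "h' \<le> 1" and "h \<le> 1"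
  shows "(1 - (h' - h)) * reg_f K (Suc k) h' \<le> reg_f K k h"
proof (cases "Suc k = K")
  case True
  then show ?thesis using h by (auto simp: reg_f_def)
next
  case False
  define m where "m = K - Suc k"
  have m: "m \<ge> 1" "K - k = Suc m" "Suc k < K" using False k by (auto simp: m_def)
  have "(1 - h') / real m \<le> 1" using m h by (simp add: divide_le_eq)
  then have "(1 - (h' - h)) * (1 - (1 - h') / real m) ^ m
     \<le> ((1 - (h' - h) + real m * (1 - (1 - h') / real m)) / real (Suc m)) ^ Suc m"
    using h m by (intro mult_power_le_power_weighted_mean) auto
  also have "1 - (h' - h) + real m * (1 - (1 - h') / real m) = real m + h"
  proof -
    have "real m * ((1 - h') / real m) = 1 - h'" using m by simp
    then show ?thesis by (simp only: right_diff_distrib)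
  qed
  also have "(real m + h) / real (Suc m) = 1 - (1 - h) / real (Suc m)"
    by (simp add: field_simps)
  finally show ?thesis using m by (simp add: reg_f_def m_def[symmetric])
qed

text \<open>At the last stage the regularizer vanishes on \<open>[0,1]\<close>, so its slope there is \<open>0\<close> and not
  \<open>reg_f K K\<close>; the value \<open>reg_f K K 1 = 1\<close> is only recovered through the capacity multipliers.\<close>

definition reg_slope :: "nat \<Rightarrow> nat \<Rightarrow> real \<Rightarrow> real" where
  "reg_slope K k x = (if k < K then reg_f K k x else 0)"

lemma reg_slope_bounds:
  assumes "0 \<le> x" "x \<le> 1"
  shows "0 \<le> reg_slope K k x" "reg_slope K k x \<le> 1"
proof -
  show "0 \<le> reg_slope K k x" using assms by (simp add: reg_slope_def reg_f_nonneg)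
  have "reg_f K k x \<le> 1"
    by (cases "x = 1") (use assms in \<open>auto simp: reg_f_one intro!: less_imp_le reg_f_less_one\<close>)
  then show "reg_slope K k x \<le> 1" by (simp add: reg_slope_def)
qed

lemma reg_slope_less_one: "0 \<le> x \<Longrightarrow> x < 1 \<Longrightarrow> reg_slope K k x < 1"
  by (simp add: reg_slope_def reg_f_less_one)

text \<open>\<open>\<Phi>\<close> is differentiable on the whole line, so a two-sided derivative is
  available even where \<open>stage_H\<close> is 0 or 1; \<open>reg_F\<close> itself is 0 on
  negative arguments and may have a kink at 0. In the last stage the integrand is supported on one
  point and integrates to 0.\<close>

lemma reg_F_antiderivative:
  assumes "k \<le> K"
  obtains \<Phi> where "\<And>x. (\<Phi> has_real_derivative reg_slope K k x) (at x)"
    and "\<And>x. 0 \<le> x \<Longrightarrow> x \<le> 1 \<Longrightarrow> reg_F K k x = \<Phi> x"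
proof (cases "k < K")
  case True
  define m where "m = real (K - k)"
  have m: "m > 0" using True by (simp add: m_def)
  define \<Psi> where "\<Psi> x = m / (m + 1) * (1 - (1 - x) / m) ^ Suc (K - k)" for x
  have der: "(\<Psi> has_real_derivative reg_slope K k x) (at x)" for x
  proof -
    have "((\<lambda>x. 1 - (1 - x) / m) has_real_derivative 1 / m) (at x)"
      using m by (auto intro!: derivative_eq_intros)
    from DERIV_cmult[OF DERIV_power[OF this, of "Suc (K - k)"], of "m / (m + 1)"]
    have "(\<Psi> has_real_derivative
        m / (m + 1) * (real (Suc (K - k)) * (1 - (1 - x) / m) ^ (K - k) * (1 / m))) (at x)"
      unfolding \<Psi>_def by (simp add: mult.commute mult.left_commute)
    moreover have "real (Suc (K - k)) = m + 1" by (simp add: m_def)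
    then have "m / (m + 1) * (real (Suc (K - k)) * (1 - (1 - x) / m) ^ (K - k) * (1 / m))
        = (1 - (1 - x) / m) ^ (K - k)"
      using m by (simp add: add.commute[of 1 m])
    ultimately show ?thesis using True by (simp add: reg_slope_def reg_f_def m_def)
  qed
  show thesis
  proof (rule that)
    show "((\<lambda>x. \<Psi> x - \<Psi> 0) has_real_derivative reg_slope K k x) (at x)" for x
      using der[of x] by (auto intro!: derivative_eq_intros)
    fix x :: real assume x: "0 \<le> x" "x \<le> 1"
    have "(reg_f K k has_integral (\<Psi> x - \<Psi> 0)) {0..x}"
    proof (rule fundamental_theorem_of_calculus[OF x(1)])
      fix t assume "t \<in> {0..x}"
      show "(\<Psi> has_vector_derivative reg_f K k t) (at t within {0..x})"
        using der[of t] True unfolding has_real_derivative_iff_has_vector_derivative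
        by (auto simp: reg_slope_def intro: has_vector_derivative_at_within)
    qed
    then show "reg_F K k x = \<Psi> x - \<Psi> 0" by (simp add: reg_F_def integral_unique)
  qed
next
  case False
  then have k: "k = K" using assms by simp
  show thesis
  proof (rule that)
    show "((\<lambda>_. 0) has_real_derivative reg_slope K k x) (at x)" for x
      using False by (simp add: reg_slope_def)
    fix x :: real
    have "(reg_f K k has_integral 0) {0..x}"
    proof (rule has_integral_spike[of "{1}" _ _ "\<lambda>_. 0"])
      show "reg_f K k t = 0" if "t \<in> {0..x} - {1}" for t
        using that by (simp add: reg_f_def k)
    qed auto
    then show "reg_F K k x = 0" by (simp add: reg_F_def integral_unique)
  qed
qed

section \<open>The competitive ratio and the charging inequality for one level\<close>

lemma Gamma_ratio_eq: "1 \<le> K \<Longrightarrow> Gamma_ratio K = 1 - reg_f K 0 0"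
  by (simp add: Gamma_ratio_def reg_f_def)

lemma Gamma_ratio_pos: "1 \<le> K \<Longrightarrow> 0 < Gamma_ratio K"
  by (simp add: Gamma_ratio_eq reg_f_less_one)

text \<open>The prices \<open>1 - a k\<close>, charged on the growth of \<open>h\<close>, collect in total at least \<open>\<Gamma> - a k\<close> for
  every \<open>k\<close>: by \<open>reg_f_step\<close> the lower bounds telescope, and monotonicity of \<open>h\<close> protects the
  amount collected up to stage \<open>k\<close> from later stages.\<close>

lemma stagewise_charging:
  fixes h a X :: "nat \<Rightarrow> real"
  assumes K: "K \<ge> 1" and h0: "h 0 = 0"
    and h: "\<And>k. k \<in> {1..K} \<Longrightarrow> 0 \<le> h k \<and> h k \<le> 1 \<and> h (k - 1) \<le> h k"
    and a: "\<And>k. k \<in> {1..K} \<Longrightarrow> 0 \<le> a k \<and> a k \<le> 1 - reg_slope K k (h k)"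
    and a_eq: "\<And>k. k \<in> {1..K} \<Longrightarrow> h k < 1 \<Longrightarrow> a k = 1 - reg_slope K k (h k)"
    and X: "\<And>k. k \<in> {1..K} \<Longrightarrow> 0 \<le> X k" and X1: "(\<Sum>k=1..K. X k) \<le> 1"
  shows "Gamma_ratio K * (\<Sum>k=1..K. X k) \<le> h K + (\<Sum>k=1..K. a k * (X k + h (k - 1) - h k))"
proof -
  define A where "A k = (\<Sum>s=1..k. (1 - a s) * (h s - h (s - 1)))" for k
  have a1: "a k \<le> 1" if "k \<in> {1..K}" for k
    using a[OF that] h[OF that] reg_slope_bounds(1)[of "h k" K k] by linarith
  have A_step: "A k \<le> A (Suc k)" if "Suc k \<le> K" for k
  proof -
    have "0 \<le> (1 - a (Suc k)) * (h (Suc k) - h k)"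
      using that h[of "Suc k"] a1[of "Suc k"] by (intro mult_nonneg_nonneg) auto
    then show ?thesis by (simp add: A_def)
  qed
  have A_mono: "A k \<le> A l" if "k \<le> l" "l \<le> K" for k l
    using that by (induction l rule: dec_induct) (auto intro: order_trans A_step)
  have AK0: "0 \<le> A K" using A_mono[of 0 K] by (simp add: A_def)
  \<comment> \<open>\<open>b\<close> extends the prices \<open>1 - a k\<close> to index 0. There is
    no stage 0, but the formula of \<open>reg_f\<close> at index 0 and argument 0 gives the starting
    value of the telescoping, \<open>1 - Gamma_ratio K\<close>.\<close>
  define b where "b k = (if k = 0 then reg_f K 0 0 else 1 - a k)" for k
  have b_ge: "reg_f K k (h k) \<le> b k" if "k < K" for k
    using that a[of k] h0 by (auto simp: b_def reg_slope_def)
  \<comment> \<open>The bound opposite to \<open>b_ge\<close>. At \<open>h (Suc k) = 1\<close> the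
    regularizer is 1 and \<open>0 \<le> a (Suc k)\<close> suffices. Below 1 the value of
    \<open>a\<close> is forced, and in the last stage \<open>reg_slope\<close> and
    \<open>reg_f\<close> are then both 0.\<close>
  have b_le: "b (Suc k) \<le> reg_f K (Suc k) (h (Suc k))" if "Suc k \<le> K" for k
  proof (cases "h (Suc k) = 1")
    case True
    then show ?thesis using a[of "Suc k"] that by (simp add: b_def reg_f_one)
  next
    case False
    then have "h (Suc k) < 1" using h[of "Suc k"] that by auto
    then show ?thesis using a_eq[of "Suc k"] that by (auto simp: b_def reg_slope_def reg_f_def)
  qed
  have h01: "0 \<le> h k \<and> h k \<le> 1" if "k \<le> K" for k
    using that h[of k] h0 by (cases "k = 0") auto
  have A_ge: "b k - reg_f K 0 0 \<le> A k" if "k \<le> K" for k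
    using that
  proof (induction k)
    case 0
    then show ?case by (simp add: A_def b_def)
  next
    case (Suc k)
    \<comment> \<open>Both bounds on \<open>b\<close>, chained through \<open>reg_f_step\<close>,
      show that \<open>A\<close> grows in this step by at least
      \<open>b (Suc k) - b k\<close>.\<close>
    have "(1 - (h (Suc k) - h k)) * b (Suc k)
        \<le> (1 - (h (Suc k) - h k)) * reg_f K (Suc k) (h (Suc k))"
      using b_le[of k] Suc.prems h01[of k] h01[of "Suc k"] by (intro mult_left_mono) auto
    also have "\<dots> \<le> reg_f K k (h k)"
      using Suc.prems h01[of k] h01[of "Suc k"] by (intro reg_f_step) auto
    also have "\<dots> \<le> b k" using b_ge Suc.prems by simp
    finally have "b (Suc k) - b k \<le> b (Suc k) * (h (Suc k) - h k)" by (simp add: algebra_simps)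
    moreover have "A (Suc k) = A k + b (Suc k) * (h (Suc k) - h k)" by (simp add: A_def b_def)
    ultimately show ?case using Suc by simp
  qed
  have "(Gamma_ratio K - A K) * X k \<le> a k * X k" if k: "k \<in> {1..K}" for k
  proof (rule mult_right_mono)
    show "Gamma_ratio K - A K \<le> a k"
      using A_ge[of k] A_mono[of k K] k K by (simp add: Gamma_ratio_eq b_def)
  qed (use X k in auto)
  then have "(\<Sum>k=1..K. (Gamma_ratio K - A K) * X k) \<le> (\<Sum>k=1..K. a k * X k)"
    by (rule sum_mono)
  then have "(Gamma_ratio K - A K) * (\<Sum>k=1..K. X k) \<le> (\<Sum>k=1..K. a k * X k)"
    by (simp add: sum_distrib_left)
  \<comment> \<open>Only the part weighted by \<open>A K\<close> is estimated by the total mass; the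
    resulting \<open>A K\<close> is the one produced by the telescoped growth of \<open>h\<close>
    below.\<close>
  moreover have "A K * (\<Sum>k=1..K. X k) \<le> A K * 1"
    using AK0 X1 by (intro mult_left_mono)
  moreover have "(\<Sum>k=1..l. h k - h (k - 1)) = h l" for l
    by (induction l) (auto simp: h0)
  then have "(\<Sum>k=1..K. a k * (X k + h (k - 1) - h k)) = (\<Sum>k=1..K. a k * X k) + A K - h K"
    unfolding A_def by (simp add: algebra_simps sum.distrib sum_subtractf)
  ultimately show ?thesis by (simp add: algebra_simps)
qed

section \<open>Lagrange multipliers for convex-like problems\<close>

text \<open>The multiplier is the supremum of the slopes \<open>(L p - v) / g p\<close> over the
  points with \<open>g p > 0\<close>; every point with \<open>g q < 0\<close> bounds these slopes
  from above. A mixture only has to be dominated by some point in the values of \<open>L\<close> and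
  \<open>g\<close>, so the domain needs no linear structure.\<close>

lemma convexlike_multiplier:
  fixes L g :: "'a \<Rightarrow> real"
  assumes mix: "\<And>p q t. p \<in> S \<Longrightarrow> q \<in> S \<Longrightarrow> 0 \<le> t \<Longrightarrow> t \<le> 1 \<Longrightarrow>
      \<exists>r\<in>S. (1 - t) * L p + t * L q \<le> L r \<and> g r \<le> (1 - t) * g p + t * g q"
    and slater: "p0 \<in> S" "g p0 < 0"
    and opt: "\<And>p. p \<in> S \<Longrightarrow> g p \<le> 0 \<Longrightarrow> L p \<le> v"
  shows "\<exists>\<theta>\<ge>0. \<forall>p\<in>S. L p - \<theta> * g p \<le> v"
proof -
  \<comment> \<open>The element 0 makes \<open>Sup R\<close> nonnegative and keeps \<open>R\<close>
    nonempty when no point violates the constraint.\<close>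
  define R where "R = insert 0 {(L p - v) / g p | p. p \<in> S \<and> g p > 0}"
  have slope: "r \<le> (v - L q) / (- g q)" if r: "r \<in> R" and q: "q \<in> S" "g q < 0" for r q
  proof (cases "r = 0")
    case True
    then show ?thesis using opt[of q] q by (simp add: divide_nonneg_neg divide_nonneg_pos del: minus_divide_right)
  next
    case False
    then obtain p where p: "p \<in> S" "g p > 0" "r = (L p - v) / g p" using r by (auto simp: R_def)
    \<comment> \<open>With this weight the mixed constraint value is 0, so \<open>opt\<close>
      applies to the point that dominates the mixture.\<close>
    define t where "t = - g q / (g p - g q)"
    have t: "0 \<le> t" "t \<le> 1" "(1 - t) * g q + t * g p = 0"
      using p q by (auto simp: t_def field_simps)
    obtain s where s: "s \<in> S" "(1 - t) * L q + t * L p \<le> L s" "g s \<le> (1 - t) * g q + t * g p"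
      using mix[OF q(1) p(1) t(1,2)] by blast
    then have "(1 - t) * L q + t * L p \<le> v" using opt[of s] t by simp
    then have "(g p - g q) * ((1 - t) * L q + t * L p) \<le> (g p - g q) * v"
      using p q by (intro mult_left_mono) auto
    moreover have "(g p - g q) * t = - g q" "(g p - g q) * (1 - t) = g p"
      using p q by (auto simp: t_def field_simps)
    then have "(g p - g q) * ((1 - t) * L q + t * L p) = g p * L q - g q * L p"
      by (simp only: distrib_left mult.assoc[symmetric])
    ultimately have "(L p - v) * (- g q) \<le> (v - L q) * g p" by (simp add: algebra_simps)
    moreover have "0 < g p" "0 < - g q" using p q by auto
    ultimately show ?thesis
      unfolding p(3) by (simp only: pos_divide_le_eq pos_le_divide_eq times_divide_eq_left)
  qed
  have bdd: "bdd_above R" by (rule bdd_aboveI) (rule slope[OF _ slater])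
  have R: "R \<noteq> {}" "0 \<in> R" by (auto simp: R_def)
  have "L p - Sup R * g p \<le> v" if p: "p \<in> S" for p
  proof (cases "g p" "0 :: real" rule: linorder_cases)
    case less
    have "Sup R \<le> (v - L p) / (- g p)" using slope[OF _ p less] R by (intro cSup_least) auto
    then show ?thesis using less by (simp add: field_simps)
  next
    case equal
    then show ?thesis using opt[OF p] by simp
  next
    case greater
    then have "(L p - v) / g p \<le> Sup R" using bdd p by (intro cSup_upper) (auto simp: R_def)
    then show ?thesis using greater by (simp add: field_simps)
  qed
  moreover have "0 \<le> Sup R" using bdd R by (intro cSup_upper)
  ultimately show ?thesis by blast
qed

text \<open>Induction over the constraints. Constraint \<open>i\<close> is first absorbed into the
  domain while the others are priced; then \<open>i\<close> is priced by
  \<open>convexlike_multiplier\<close>, with the Lagrangian of the others as objective.\<close>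

lemma convexlike_multipliers:
  fixes L :: "'a \<Rightarrow> real" and g :: "'j \<Rightarrow> 'a \<Rightarrow> real"
  assumes "finite J"
    and "\<And>p q t. p \<in> S \<Longrightarrow> q \<in> S \<Longrightarrow> 0 \<le> t \<Longrightarrow> t \<le> 1 \<Longrightarrow>
      \<exists>r\<in>S. (1 - t) * L p + t * L q \<le> L r \<and> (\<forall>j\<in>J. g j r \<le> (1 - t) * g j p + t * g j q)"
    and "p0 \<in> S" "\<And>j. j \<in> J \<Longrightarrow> g j p0 < 0"
    and "\<And>p. p \<in> S \<Longrightarrow> (\<And>j. j \<in> J \<Longrightarrow> g j p \<le> 0) \<Longrightarrow> L p \<le> v"
  shows "\<exists>\<theta>. (\<forall>j\<in>J. 0 \<le> \<theta> j) \<and> (\<forall>p\<in>S. L p - (\<Sum>j\<in>J. \<theta> j * g j p) \<le> v)"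
  using assms
proof (induction J arbitrary: S rule: finite_induct)
  case empty
  then show ?case by auto
next
  case (insert i J)
  define S' where "S' = {p \<in> S. g i p \<le> 0}"
  have "\<exists>\<theta>. (\<forall>j\<in>J. 0 \<le> \<theta> j) \<and> (\<forall>p\<in>S'. L p - (\<Sum>j\<in>J. \<theta> j * g j p) \<le> v)"
  proof (rule insert.IH)
    fix p q and t :: real assume pq: "p \<in> S'" "q \<in> S'" and t: "0 \<le> t" "t \<le> 1"
    then obtain r where r: "r \<in> S" "(1 - t) * L p + t * L q \<le> L r"
        "\<forall>j\<in>insert i J. g j r \<le> (1 - t) * g j p + t * g j q"
      using insert.prems(1)[of p q t] by (auto simp: S'_def)
    have "(1 - t) * g i p + t * g i q \<le> 0"
      using pq t by (auto simp: S'_def intro!: add_nonpos_nonpos mult_nonneg_nonpos)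
    then have "r \<in> S'" using r by (force simp: S'_def)
    then show "\<exists>r\<in>S'. (1 - t) * L p + t * L q \<le> L r \<and>
        (\<forall>j\<in>J. g j r \<le> (1 - t) * g j p + t * g j q)" using r by auto
  next
    show "p0 \<in> S'" using insert.prems(2) insert.prems(3)[of i] by (auto simp: S'_def less_imp_le)
    show "g j p0 < 0" if "j \<in> J" for j using that insert.prems(3) by auto
    show "L p \<le> v" if "p \<in> S'" "\<And>j. j \<in> J \<Longrightarrow> g j p \<le> 0" for p
      using that by (intro insert.prems(4)) (auto simp: S'_def)
  qed
  then obtain \<theta> where \<theta>: "\<forall>j\<in>J. 0 \<le> \<theta> j"
      and opt: "\<forall>p\<in>S'. L p - (\<Sum>j\<in>J. \<theta> j * g j p) \<le> v" by blast
  have "\<exists>\<mu>\<ge>0. \<forall>p\<in>S. (L p - (\<Sum>j\<in>J. \<theta> j * g j p)) - \<mu> * g i p \<le> v"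
  proof (rule convexlike_multiplier)
    fix p q and t :: real assume pq: "p \<in> S" "q \<in> S" and t: "0 \<le> t" "t \<le> 1"
    then obtain r where r: "r \<in> S" "(1 - t) * L p + t * L q \<le> L r"
        "\<forall>j\<in>insert i J. g j r \<le> (1 - t) * g j p + t * g j q"
      using insert.prems(1)[of p q t] by blast
    \<comment> \<open>Nonnegative multipliers keep the Lagrangian over \<open>J\<close>
      convex-like.\<close>
    have "(\<Sum>j\<in>J. \<theta> j * g j r) \<le> (\<Sum>j\<in>J. \<theta> j * ((1 - t) * g j p + t * g j q))"
      using r \<theta> by (intro sum_mono mult_left_mono) auto
    also have "\<dots> = (1 - t) * (\<Sum>j\<in>J. \<theta> j * g j p) + t * (\<Sum>j\<in>J. \<theta> j * g j q)"
      by (simp add: sum_distrib_left sum.distrib[symmetric] algebra_simps)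
    finally show "\<exists>r\<in>S. (1 - t) * (L p - (\<Sum>j\<in>J. \<theta> j * g j p)) +
          t * (L q - (\<Sum>j\<in>J. \<theta> j * g j q)) \<le> L r - (\<Sum>j\<in>J. \<theta> j * g j r)
        \<and> g i r \<le> (1 - t) * g i p + t * g i q"
      using r by (intro bexI[of _ r]) (auto simp: algebra_simps)
  next
    show "p0 \<in> S" "g i p0 < 0" using insert.prems by auto
    show "L p - (\<Sum>j\<in>J. \<theta> j * g j p) \<le> v" if "p \<in> S" "g i p \<le> 0" for p
      using that opt by (auto simp: S'_def)
  qed
  then obtain \<mu> where \<mu>: "\<mu> \<ge> 0" "\<forall>p\<in>S. L p - (\<Sum>j\<in>J. \<theta> j * g j p) - \<mu> * g i p \<le> v" by blast
  have "(\<Sum>j\<in>insert i J. (\<theta>(i := \<mu>)) j * g j p) = \<mu> * g i p + (\<Sum>j\<in>J. \<theta> j * g j p)" for p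
    using insert.hyps by (simp cong: sum.cong) (auto intro!: sum.cong)
  then show ?case
    using \<theta> \<mu> insert.hyps by (intro exI[of _ "\<theta>(i := \<mu>)"]) (auto simp: algebra_simps)
qed

section \<open>Optimality conditions of a stage\<close>

locale mca_stages =
  fixes K :: nat and I :: "('u, 'c, 'v) mca"
  assumes inst: "mca_instance K I"
begin

abbreviation "V \<equiv> advertisers I"
abbreviation "T \<equiv> top_level I"
abbreviation "B k \<equiv> batch I k \<times> configs I"

section \<open>Price levels and summation by parts\<close>

definition gap :: "nat \<Rightarrow> real" where
  "gap \<tau> = level I \<tau> - level I (\<tau> - 1)"

text \<open>The cutoff is a value and not a level index, so that a price of the instance can be
  inserted directly.\<close>

definition cum :: "(nat \<Rightarrow> real) \<Rightarrow> real \<Rightarrow> real" where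
  "cum e p = (\<Sum>\<tau> | \<tau> \<in> {1..T} \<and> level I \<tau> \<le> p. e \<tau>)"

definition load :: "nat \<Rightarrow> ('u \<Rightarrow> 'c \<Rightarrow> 'v \<Rightarrow> real) \<Rightarrow> ('v \<Rightarrow> nat \<Rightarrow> real) \<Rightarrow> 'v \<Rightarrow> real" where
  "load k x y j = (\<Sum>(i, c)\<in>B k. x i c j) + (\<Sum>\<tau>=1..T. y j \<tau>)"

lemma finite_V: "finite V"
  using inst by (simp add: mca_instance_def)

lemma finite_B: "k \<in> {1..K} \<Longrightarrow> finite (B k)"
  using inst by (auto simp: mca_instance_def)

lemma level_le_iff: "s \<le> T \<Longrightarrow> t \<le> T \<Longrightarrow> level I s \<le> level I t \<longleftrightarrow> s \<le> t"
  using inst strict_mono_on_less_eq[of "{0..T}" "level I" s t] by (auto simp: mca_instance_def)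

lemma level_0: "level I 0 = 0"
  using inst by (simp add: mca_instance_def)

lemma gap_pos: "\<tau> \<in> {1..T} \<Longrightarrow> 0 < gap \<tau>"
  using level_le_iff[of \<tau> "\<tau> - 1"] by (cases \<tau>) (auto simp: gap_def not_le[symmetric])

lemma priceE:
  assumes "k \<in> {1..K}" "i \<in> batch I k" "c \<in> configs I" "j \<in> V"
  obtains t where "t \<le> T" "price I i c j = level I t"
proof -
  have "i \<in> users K I" using assms by (auto simp: users_def)
  then have "price I i c j \<in> level I ` {0..T}" using assms inst by (simp add: mca_instance_def)
  then show ?thesis by (auto intro: that)
qed

lemma cum_level: "t \<le> T \<Longrightarrow> cum e (level I t) = (\<Sum>\<tau>=1..t. e \<tau>)"
  unfolding cum_def by (rule sum.cong) (auto simp: level_le_iff)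

lemma cum_gap: "t \<le> T \<Longrightarrow> cum gap (level I t) = level I t"
proof -
  have "(\<Sum>\<tau>=1..t. gap \<tau>) = level I t" for t
    by (induction t) (auto simp: gap_def level_0)
  then show "t \<le> T \<Longrightarrow> ?thesis" by (simp add: cum_level)
qed

lemma cum_mono: "(\<And>\<tau>. \<tau> \<in> {1..T} \<Longrightarrow> 0 \<le> e \<tau>) \<Longrightarrow> p \<le> q \<Longrightarrow> cum e p \<le> cum e q"
  unfolding cum_def by (intro sum_mono2) auto

text \<open>An impression of price \<open>p\<close> is counted in \<open>stage_H\<close> at every
  level of value at most \<open>p\<close>, so exchanging the sums gives it the total weight
  \<open>cum e p\<close>.\<close>

lemma sum_stage_H:
  assumes k: "k \<in> {1..K}"
  shows "(\<Sum>\<tau>=1..T. e \<tau> * stage_H I k x y j \<tau>)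
     = (\<Sum>(i, c)\<in>B k. cum e (price I i c j) * x i c j) + (\<Sum>\<tau>=1..T. cum e (level I \<tau>) * y j \<tau>)"
proof -
  have "(\<Sum>\<tau>=1..T. e \<tau> * (\<Sum>(i, c)\<in>{(i, c). i \<in> batch I k \<and> c \<in> configs I \<and> price I i c j \<ge> level I \<tau>}. x i c j))
     = (\<Sum>\<tau>=1..T. \<Sum>(i, c)\<in>B k. if price I i c j \<ge> level I \<tau> then e \<tau> * x i c j else 0)"
  proof (intro sum.cong refl)
    fix \<tau>
    have "{(i, c). i \<in> batch I k \<and> c \<in> configs I \<and> price I i c j \<ge> level I \<tau>}
        = {ic \<in> B k. price I (fst ic) (snd ic) j \<ge> level I \<tau>}" by auto
    then show "e \<tau> * (\<Sum>(i, c)\<in>{(i, c). i \<in> batch I k \<and> c \<in> configs I \<and> price I i c j \<ge> level I \<tau>}. x i c j)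
      = (\<Sum>(i, c)\<in>B k. if price I i c j \<ge> level I \<tau> then e \<tau> * x i c j else 0)"
      using finite_B[OF k]
      by (simp only: sum.inter_filter sum_distrib_left) (auto intro!: sum.cong)
  qed
  also have "\<dots> = (\<Sum>ic\<in>B k. \<Sum>\<tau>=1..T. if price I (fst ic) (snd ic) j \<ge> level I \<tau>
      then e \<tau> * x (fst ic) (snd ic) j else 0)"
    by (subst sum.swap) (simp add: case_prod_beta)
  also have "\<dots> = (\<Sum>(i, c)\<in>B k. cum e (price I i c j) * x i c j)"
    unfolding cum_def sum_distrib_right
    by (intro sum.cong refl) (simp add: case_prod_beta sum.inter_filter[symmetric])
  finally have 1: "(\<Sum>\<tau>=1..T. e \<tau> * (\<Sum>(i, c)\<in>{(i, c). i \<in> batch I k \<and> c \<in> configs I \<and> price I i c j \<ge> level I \<tau>}. x i c j))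
     = (\<Sum>(i, c)\<in>B k. cum e (price I i c j) * x i c j)" .
  have "(\<Sum>\<tau>=1..T. e \<tau> * (\<Sum>\<tau>'=\<tau>..T. y j \<tau>')) = (\<Sum>\<tau>=1..T. \<Sum>\<tau>'=1..T. if \<tau> \<le> \<tau>' then e \<tau> * y j \<tau>' else 0)"
  proof (intro sum.cong refl)
    fix \<tau> assume "\<tau> \<in> {1..T}"
    then have "{\<tau>..T} = {\<tau>' \<in> {1..T}. \<tau> \<le> \<tau>'}" by auto
    then show "e \<tau> * (\<Sum>\<tau>'=\<tau>..T. y j \<tau>') = (\<Sum>\<tau>'=1..T. if \<tau> \<le> \<tau>' then e \<tau> * y j \<tau>' else 0)"
      by (simp only: sum.inter_filter sum_distrib_left finite_atLeastAtMost) (auto intro!: sum.cong)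
  qed
  also have "\<dots> = (\<Sum>\<tau>'=1..T. \<Sum>\<tau>=1..T. if \<tau> \<le> \<tau>' then e \<tau> * y j \<tau>' else 0)"
    by (rule sum.swap)
  also have "\<dots> = (\<Sum>\<tau>=1..T. cum e (level I \<tau>) * y j \<tau>)"
    unfolding cum_def sum_distrib_right
    by (rule sum.cong[OF refl], subst sum.inter_filter) (auto simp: level_le_iff intro!: sum.cong)
  finally show ?thesis
    unfolding stage_H_def distrib_left sum.distrib 1 by (rule arg_cong)
qed

section \<open>Linearity in the allocation and convexity of the stage constraints\<close>

lemma stage_H_mix:
  "stage_H I k (\<lambda>i c j. (1 - t) * x i c j + t * x' i c j) (\<lambda>j \<tau>. (1 - t) * y j \<tau> + t * y' j \<tau>) j \<tau>
    = (1 - t) * stage_H I k x y j \<tau> + t * stage_H I k x' y' j \<tau>"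
  unfolding stage_H_def by (simp add: sum.distrib sum_distrib_left case_prod_beta distrib_left add_ac)

lemma load_mix:
  "load k (\<lambda>i c j. (1 - t) * x i c j + t * x' i c j) (\<lambda>j \<tau>. (1 - t) * y j \<tau> + t * y' j \<tau>) j
    = (1 - t) * load k x y j + t * load k x' y' j"
  unfolding load_def by (simp add: sum.distrib sum_distrib_left case_prod_beta distrib_left add_ac)

text \<open>The constraints of the stage program without the capacities of the advertisers; only the
  capacities receive multipliers.\<close>

definition relaxed :: "nat \<Rightarrow> ('v \<Rightarrow> nat \<Rightarrow> real) \<Rightarrow>
    ('u \<Rightarrow> 'c \<Rightarrow> 'v \<Rightarrow> real) \<Rightarrow> ('v \<Rightarrow> nat \<Rightarrow> real) \<Rightarrow> ('u \<Rightarrow> 'c \<Rightarrow> real) \<Rightarrow> bool" where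
  "relaxed k \<eta> x y z \<longleftrightarrow>
     (\<forall>i\<in>batch I k. \<forall>c\<in>configs I. \<forall>j\<in>V. 0 \<le> x i c j \<and> x i c j \<le> imps I i c j * z i c) \<and>
     (\<forall>j\<in>V. \<forall>\<tau>\<in>{1..T}. 0 \<le> y j \<tau> \<and> y j \<tau> \<le> \<eta> j \<tau>) \<and>
     (\<forall>i\<in>batch I k. (\<forall>c\<in>configs I. 0 \<le> z i c) \<and> (\<Sum>c\<in>configs I. z i c) \<le> 1)"

lemma stage_feasible_iff:
  "stage_feasible I k \<eta> x y z \<longleftrightarrow> relaxed k \<eta> x y z \<and> (\<forall>j\<in>V. load k x y j \<le> 1)"
  unfolding stage_feasible_def relaxed_def load_def by (auto simp: sum.cartesian_product)

lemma relaxed_mix: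
  assumes p: "relaxed k \<eta> x y z" and q: "relaxed k \<eta> x' y' z'" and t: "0 \<le> t" "t \<le> 1"
  shows "relaxed k \<eta> (\<lambda>i c j. (1 - t) * x i c j + t * x' i c j)
    (\<lambda>j \<tau>. (1 - t) * y j \<tau> + t * y' j \<tau>) (\<lambda>i c. (1 - t) * z i c + t * z' i c)"
proof -
  have mix_le: "(1 - t) * a + t * b \<le> (1 - t) * a' + t * b'" if "a \<le> a'" "b \<le> b'" for a b a' b' :: real
    using that t by (intro add_mono mult_left_mono) auto
  have mix_nonneg: "0 \<le> (1 - t) * a + t * b" if "0 \<le> a" "0 \<le> b" for a b :: real
    using mix_le[OF that] by simp
  have "(1 - t) * x i c j + t * x' i c j \<le> imps I i c j * ((1 - t) * z i c + t * z' i c)"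
    if "i \<in> batch I k" "c \<in> configs I" "j \<in> V" for i c j
  proof -
    have "(1 - t) * x i c j + t * x' i c j
        \<le> (1 - t) * (imps I i c j * z i c) + t * (imps I i c j * z' i c)"
      using p q that by (intro mix_le) (auto simp: relaxed_def)
    then show ?thesis by (simp add: algebra_simps)
  qed
  moreover have "(1 - t) * y j \<tau> + t * y' j \<tau> \<le> \<eta> j \<tau>" if "j \<in> V" "\<tau> \<in> {1..T}" for j \<tau>
  proof -
    have "(1 - t) * y j \<tau> + t * y' j \<tau> \<le> (1 - t) * \<eta> j \<tau> + t * \<eta> j \<tau>"
      using p q that by (intro mix_le) (auto simp: relaxed_def)
    then show ?thesis by (simp add: algebra_simps)
  qed
  moreover have "(\<Sum>c\<in>configs I. (1 - t) * z i c + t * z' i c) \<le> 1" if "i \<in> batch I k" for i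
  proof -
    have "(1 - t) * (\<Sum>c\<in>configs I. z i c) + t * (\<Sum>c\<in>configs I. z' i c) \<le> (1 - t) * 1 + t * 1"
      using p q that by (intro mix_le) (auto simp: relaxed_def)
    then show ?thesis by (simp add: sum.distrib sum_distrib_left)
  qed
  moreover have "0 \<le> (1 - t) * x i c j + t * x' i c j"
    if "i \<in> batch I k" "c \<in> configs I" "j \<in> V" for i c j
    using p q that by (auto simp: relaxed_def intro!: mix_nonneg)
  moreover have "0 \<le> (1 - t) * z i c + t * z' i c" if "i \<in> batch I k" "c \<in> configs I" for i c
    using p q that by (auto simp: relaxed_def intro!: mix_nonneg)
  moreover have "0 \<le> (1 - t) * y j \<tau> + t * y' j \<tau>" if "j \<in> V" "\<tau> \<in> {1..T}" for j \<tau>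
    using p q that by (auto simp: relaxed_def intro!: mix_nonneg)
  ultimately show ?thesis unfolding relaxed_def by blast
qed

section \<open>The stage objective through \<open>stage_H\<close>, and its first-order
  condition\<close>

lemma sum_gap_stage_H:
  assumes k: "k \<in> {1..K}" and j: "j \<in> V"
  shows "(\<Sum>\<tau>=1..T. gap \<tau> * stage_H I k x y j \<tau>) =
      (\<Sum>(i, c)\<in>B k. price I i c j * x i c j) + (\<Sum>\<tau>=1..T. level I \<tau> * y j \<tau>)"
proof -
  have "cum gap (price I i c j) = price I i c j" if "i \<in> batch I k" "c \<in> configs I" for i c
    using that k j by (elim priceE[of k i c j]) (auto simp: cum_gap)
  then show ?thesis
    unfolding sum_stage_H[OF k] by (intro arg_cong2[of _ _ _ _ "(+)"] sum.cong) (auto simp: cum_gap)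
qed

lemma stage_objective_eq:
  assumes k: "k \<in> {1..K}"
  shows "stage_objective K I k \<eta> x y =
    (\<Sum>j\<in>V. \<Sum>\<tau>=1..T. gap \<tau> * (stage_H I k x y j \<tau> - reg_F K k (stage_H I k x y j \<tau>)))
    - (\<Sum>j\<in>V. \<Sum>\<tau>=1..T. level I \<tau> * \<eta> j \<tau>)"
proof -
  have "(\<Sum>i\<in>batch I k. \<Sum>c\<in>configs I. \<Sum>j\<in>V. price I i c j * x i c j)
      = (\<Sum>j\<in>V. \<Sum>(i, c)\<in>B k. price I i c j * x i c j)"
  proof -
    have "(\<Sum>i\<in>batch I k. \<Sum>c\<in>configs I. \<Sum>j\<in>V. price I i c j * x i c j)
        = (\<Sum>i\<in>batch I k. \<Sum>j\<in>V. \<Sum>c\<in>configs I. price I i c j * x i c j)"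
      by (intro sum.cong refl sum.swap)
    also have "\<dots> = (\<Sum>j\<in>V. \<Sum>i\<in>batch I k. \<Sum>c\<in>configs I. price I i c j * x i c j)"
      by (rule sum.swap)
    finally show ?thesis by (simp only: sum.cartesian_product)
  qed
  moreover have "(\<Sum>j\<in>V. \<Sum>\<tau>=1..T. gap \<tau> * stage_H I k x y j \<tau>)
      = (\<Sum>j\<in>V. (\<Sum>(i, c)\<in>B k. price I i c j * x i c j) + (\<Sum>\<tau>=1..T. level I \<tau> * y j \<tau>))"
    by (intro sum.cong refl sum_gap_stage_H k)
  ultimately show ?thesis
    unfolding stage_objective_def gap_def[symmetric]
    by (simp add: right_diff_distrib sum_subtractf sum.distrib)
qed

lemma stage_H_bounds:
  assumes k: "k \<in> {1..K}" and p: "relaxed k \<eta> x y z" and j: "j \<in> V" and \<tau>: "\<tau> \<in> {1..T}"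
  shows "0 \<le> stage_H I k x y j \<tau>" "stage_H I k x y j \<tau> \<le> load k x y j"
proof -
  let ?P = "{(i, c). i \<in> batch I k \<and> c \<in> configs I \<and> price I i c j \<ge> level I \<tau>}"
  have P: "?P \<subseteq> B k" by auto
  have x: "0 \<le> (case ic of (i, c) \<Rightarrow> x i c j)" if "ic \<in> B k" for ic
    using that p j by (auto simp: relaxed_def)
  have y: "0 \<le> y j t" if "t \<in> {1..T}" for t
    using that p j by (auto simp: relaxed_def)
  show "0 \<le> stage_H I k x y j \<tau>"
    unfolding stage_H_def using x y \<tau> P by (intro add_nonneg_nonneg sum_nonneg) (auto split: prod.splits)
  show "stage_H I k x y j \<tau> \<le> load k x y j"
    unfolding stage_H_def load_def using x y \<tau> P finite_B[OF k]
    by (intro add_mono sum_mono2) auto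
qed

text \<open>The left side minus the right side is the derivative at 0 of the objective along the
  segment from the optimum to the competitor, which cannot be positive.\<close>

lemma stage_variational:
  assumes k: "k \<in> {1..K}" and opt: "stage_optimal K I k \<eta> x y z"
    and q: "stage_feasible I k \<eta> x' y' z'"
  shows "(\<Sum>j\<in>V. \<Sum>\<tau>=1..T. gap \<tau> * (1 - reg_slope K k (stage_H I k x y j \<tau>)) * stage_H I k x' y' j \<tau>)
    \<le> (\<Sum>j\<in>V. \<Sum>\<tau>=1..T. gap \<tau> * (1 - reg_slope K k (stage_H I k x y j \<tau>)) * stage_H I k x y j \<tau>)"
proof -
  define h where "h j \<tau> = stage_H I k x y j \<tau>" for j \<tau>
  define h' where "h' j \<tau> = stage_H I k x' y' j \<tau>" for j \<tau>
  have p: "stage_feasible I k \<eta> x y z" using opt by (simp add: stage_optimal_def)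
  obtain \<Phi> where der: "\<And>x. (\<Phi> has_real_derivative reg_slope K k x) (at x)"
      and \<Phi>: "\<And>x. 0 \<le> x \<Longrightarrow> x \<le> 1 \<Longrightarrow> reg_F K k x = \<Phi> x"
    using reg_F_antiderivative[of k K] k by auto
  \<comment> \<open>On \<open>[0,1]\<close> this is the objective along the segment up to a
    constant; \<open>\<Phi>\<close> replaces \<open>reg_F\<close> so that it is differentiable at 0
    from both sides.\<close>
  define \<phi> where "\<phi> t = (\<Sum>j\<in>V. \<Sum>\<tau>=1..T. gap \<tau> * (((1 - t) * h j \<tau> + t * h' j \<tau>)
      - \<Phi> ((1 - t) * h j \<tau> + t * h' j \<tau>)))" for t
  define l where "l = (\<Sum>j\<in>V. \<Sum>\<tau>=1..T. gap \<tau> * ((h' j \<tau> - h j \<tau>)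
      - reg_slope K k (h j \<tau>) * (h' j \<tau> - h j \<tau>)))"
  have d\<phi>: "(\<phi> has_real_derivative l) (at 0)"
    unfolding \<phi>_def l_def
  proof (intro DERIV_sum DERIV_cmult DERIV_diff)
    fix j \<tau>
    show lin: "((\<lambda>t. (1 - t) * h j \<tau> + t * h' j \<tau>) has_real_derivative h' j \<tau> - h j \<tau>) (at 0)"
      by (auto intro!: derivative_eq_intros)
    show "((\<lambda>t. \<Phi> ((1 - t) * h j \<tau> + t * h' j \<tau>)) has_real_derivative
        reg_slope K k (h j \<tau>) * (h' j \<tau> - h j \<tau>)) (at 0)"
      using DERIV_chain2[OF _ lin, of \<Phi> "reg_slope K k (h j \<tau>)"] der[of "h j \<tau>"] by simp
  qed
  have le: "\<phi> t \<le> \<phi> 0" if t: "0 \<le> t" "t \<le> 1" for t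
  proof -
    let ?x = "\<lambda>i c j. (1 - t) * x i c j + t * x' i c j" and ?y = "\<lambda>j \<tau>. (1 - t) * y j \<tau> + t * y' j \<tau>"
      and ?z = "\<lambda>i c. (1 - t) * z i c + t * z' i c"
    have "relaxed k \<eta> ?x ?y ?z"
      using p q t by (intro relaxed_mix) (simp_all only: stage_feasible_iff)
    moreover have "load k ?x ?y j \<le> 1" if j: "j \<in> V" for j
    proof -
      have "load k x y j \<le> 1" "load k x' y' j \<le> 1" using p q j by (auto simp only: stage_feasible_iff)
      then have "(1 - t) * load k x y j + t * load k x' y' j \<le> (1 - t) * 1 + t * 1"
        using t by (intro add_mono mult_left_mono) auto
      then show ?thesis unfolding load_mix by simp
    qed
    ultimately have feas: "stage_feasible I k \<eta> ?x ?y ?z"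
      unfolding stage_feasible_iff by blast
    have obj: "stage_objective K I k \<eta> x0 y0 = (\<Sum>j\<in>V. \<Sum>\<tau>=1..T.
          gap \<tau> * (stage_H I k x0 y0 j \<tau> - \<Phi> (stage_H I k x0 y0 j \<tau>)))
        - (\<Sum>j\<in>V. \<Sum>\<tau>=1..T. level I \<tau> * \<eta> j \<tau>)"
      if f: "stage_feasible I k \<eta> x0 y0 z0" for x0 y0 z0
    proof -
      have "reg_F K k (stage_H I k x0 y0 j \<tau>) = \<Phi> (stage_H I k x0 y0 j \<tau>)"
        if "j \<in> V" "\<tau> \<in> {1..T}" for j \<tau>
      proof -
        have "relaxed k \<eta> x0 y0 z0" "load k x0 y0 j \<le> 1" using f that by (auto simp: stage_feasible_iff)
        then show ?thesis using stage_H_bounds[OF k _ that] by (intro \<Phi>) (metis, metis order_trans)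
      qed
      then show ?thesis unfolding stage_objective_eq[OF k] by simp
    qed
    have "stage_objective K I k \<eta> ?x ?y \<le> stage_objective K I k \<eta> x y"
      using opt feas unfolding stage_optimal_def by blast
    then show ?thesis
      unfolding obj[OF feas] obj[OF p] by (simp add: \<phi>_def stage_H_mix h_def h'_def)
  qed
  have "l \<le> 0"
  proof (rule ccontr)
    assume "\<not> l \<le> 0"
    then obtain d where d: "d > 0" "\<And>s. 0 < s \<Longrightarrow> s < d \<Longrightarrow> \<phi> 0 < \<phi> (0 + s)"
      using DERIV_pos_inc_right[OF d\<phi>] by auto
    \<comment> \<open>Small enough for the strict increase, and at most 1 so that the point stays on
      the feasible segment.\<close>
    define s where "s = min (d / 2) 1"
    have "0 < s" "s < d" "s \<le> 1" using d(1) by (auto simp: s_def)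
    then show False using d(2)[of s] le[of s] by simp
  qed
  moreover have "l = (\<Sum>j\<in>V. \<Sum>\<tau>=1..T. gap \<tau> * (1 - reg_slope K k (h j \<tau>)) * h' j \<tau>)
      - (\<Sum>j\<in>V. \<Sum>\<tau>=1..T. gap \<tau> * (1 - reg_slope K k (h j \<tau>)) * h j \<tau>)"
    unfolding l_def sum_subtractf[symmetric] by (intro sum.cong refl) (simp add: algebra_simps)
  ultimately show ?thesis
    unfolding h_def h'_def by linarith
qed

text \<open>By \<open>stage_variational\<close> the optimum maximises a linear functional over the
  convex set \<open>relaxed\<close> under the capacities, so the capacities can be priced.
  \<open>D j p\<close> is the linearised value to \<open>j\<close> of one impression of price
  \<open>p\<close>. Testing the optimum itself yields complementary slackness.\<close>

lemma stage_multipliers: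
  assumes k: "k \<in> {1..K}" and opt: "stage_optimal K I k \<eta> x y z"
  defines "D \<equiv> \<lambda>j. cum (\<lambda>\<tau>. gap \<tau> * (1 - reg_slope K k (stage_H I k x y j \<tau>)))"
  obtains \<theta> where "\<And>j. j \<in> V \<Longrightarrow> 0 \<le> \<theta> j"
    and "\<And>j. j \<in> V \<Longrightarrow> 0 < \<theta> j \<Longrightarrow> load k x y j = 1"
    and "\<And>x' y' z'. relaxed k \<eta> x' y' z' \<Longrightarrow>
      (\<Sum>j\<in>V. (\<Sum>(i, c)\<in>B k. (D j (price I i c j) - \<theta> j) * x' i c j)
        + (\<Sum>\<tau>=1..T. (D j (level I \<tau>) - \<theta> j) * y' j \<tau>))
      \<le> (\<Sum>j\<in>V. (\<Sum>(i, c)\<in>B k. (D j (price I i c j) - \<theta> j) * x i c j)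
        + (\<Sum>\<tau>=1..T. (D j (level I \<tau>) - \<theta> j) * y j \<tau>))"
proof -
  have p: "relaxed k \<eta> x y z" and load1: "\<And>j. j \<in> V \<Longrightarrow> load k x y j \<le> 1"
    using opt by (auto simp: stage_optimal_def stage_feasible_iff)
  define L where "L x' y' = (\<Sum>j\<in>V. \<Sum>\<tau>=1..T.
      gap \<tau> * (1 - reg_slope K k (stage_H I k x y j \<tau>)) * stage_H I k x' y' j \<tau>)" for x' y'
  define S where "S = {(x', y', z'). relaxed k \<eta> x' y' z'}"
  have L_mix: "L (\<lambda>i c j. (1 - t) * x1 i c j + t * x2 i c j) (\<lambda>j \<tau>. (1 - t) * y1 j \<tau> + t * y2 j \<tau>)
      = (1 - t) * L x1 y1 + t * L x2 y2" for t x1 x2 y1 y2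
    unfolding L_def stage_H_mix
    by (simp add: sum_distrib_left sum.distrib distrib_left mult.left_commute)
  have "\<exists>\<theta>. (\<forall>j\<in>V. 0 \<le> \<theta> j) \<and> (\<forall>p\<in>S. (case p of (x', y', z') \<Rightarrow> L x' y')
      - (\<Sum>j\<in>V. \<theta> j * (case p of (x', y', z') \<Rightarrow> load k x' y' j - 1)) \<le> L x y)"
  proof (rule convexlike_multipliers[OF finite_V])
    fix p q and t :: real assume "p \<in> S" "q \<in> S" and t: "0 \<le> t" "t \<le> 1"
    then obtain x1 y1 z1 x2 y2 z2 where p: "p = (x1, y1, z1)" "relaxed k \<eta> x1 y1 z1"
      and q: "q = (x2, y2, z2)" "relaxed k \<eta> x2 y2 z2" by (auto simp: S_def)
    have mix1: "(1 - t) * a + t * b - 1 = (1 - t) * (a - 1) + t * (b - 1)" for a b :: real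
      by (simp add: algebra_simps)
    show "\<exists>r\<in>S. (1 - t) * (case p of (x', y', z') \<Rightarrow> L x' y') + t * (case q of (x', y', z') \<Rightarrow> L x' y')
          \<le> (case r of (x', y', z') \<Rightarrow> L x' y') \<and>
        (\<forall>j\<in>V. (case r of (x', y', z') \<Rightarrow> load k x' y' j - 1)
          \<le> (1 - t) * (case p of (x', y', z') \<Rightarrow> load k x' y' j - 1)
            + t * (case q of (x', y', z') \<Rightarrow> load k x' y' j - 1))"
      using relaxed_mix[OF p(2) q(2) t] unfolding p(1) q(1)
      by (intro bexI[of _ "(\<lambda>i c j. (1 - t) * x1 i c j + t * x2 i c j,
          \<lambda>j \<tau>. (1 - t) * y1 j \<tau> + t * y2 j \<tau>, \<lambda>i c. (1 - t) * z1 i c + t * z2 i c)"])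
        (simp_all add: S_def L_mix load_mix mix1)
  next
    \<comment> \<open>The empty allocation is the Slater point: its load is 0, and it is in
      \<open>relaxed\<close> because \<open>0 \<le> y \<le> \<eta>\<close> makes the state
      nonnegative.\<close>
    have "0 \<le> \<eta> j \<tau>" if "j \<in> V" "\<tau> \<in> {1..T}" for j \<tau>
      using p that by (auto simp: relaxed_def intro: order_trans[of 0 "y j \<tau>"])
    then show "(\<lambda>_ _ _. 0, \<lambda>_ _. 0, \<lambda>_ _. 0) \<in> S"
      by (simp add: S_def relaxed_def)
    show "(case (\<lambda>_ _ _. 0, \<lambda>_ _. 0, \<lambda>_ _. 0) of (x', y', z') \<Rightarrow> load k x' y' j - 1) < 0" for j
      by (simp add: load_def)
  next
    fix q assume "q \<in> S" and 1: "\<And>j. j \<in> V \<Longrightarrow> (case q of (x', y', z') \<Rightarrow> load k x' y' j - 1) \<le> 0"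
    then obtain x' y' z' where q: "q = (x', y', z')" "relaxed k \<eta> x' y' z'" by (auto simp: S_def)
    then have "stage_feasible I k \<eta> x' y' z'" using 1 by (auto simp: stage_feasible_iff)
    from stage_variational[OF k opt this]
    show "(case q of (x', y', z') \<Rightarrow> L x' y') \<le> L x y" by (simp add: q L_def)
  qed
  then obtain \<theta> where \<theta>: "\<And>j. j \<in> V \<Longrightarrow> 0 \<le> \<theta> j"
    and S: "\<forall>p\<in>S. (case p of (x', y', z') \<Rightarrow> L x' y')
      - (\<Sum>j\<in>V. \<theta> j * (case p of (x', y', z') \<Rightarrow> load k x' y' j - 1)) \<le> L x y" by blast
  have lag: "L x' y' - (\<Sum>j\<in>V. \<theta> j * (load k x' y' j - 1)) \<le> L x y"
    if "relaxed k \<eta> x' y' z'" for x' y' z'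
    using bspec[OF S, of "(x', y', z')"] that by (simp add: S_def)
  have slack: "\<theta> j * (1 - load k x y j) = 0" if j: "j \<in> V" for j
  proof -
    have nn: "0 \<le> \<theta> j * (1 - load k x y j)" if "j \<in> V" for j
      using \<theta>[OF that] load1[OF that] by simp
    \<comment> \<open>The Lagrangian bound at the optimum leaves a sum of nonnegative terms that is
      at most 0, so each term vanishes.\<close>
    have "(\<Sum>j\<in>V. \<theta> j * (1 - load k x y j)) \<le> 0"
      using lag[OF p] by (simp add: algebra_simps sum_subtractf)
    then have "(\<Sum>j\<in>V. \<theta> j * (1 - load k x y j)) = 0"
      using sum_nonneg[of V "\<lambda>j. \<theta> j * (1 - load k x y j)"] nn by force
    then show ?thesis using sum_nonneg_eq_0_iff[of V "\<lambda>j. \<theta> j * (1 - load k x y j)"] finite_V nn j by simp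
  qed
  have R: "(\<Sum>j\<in>V. (\<Sum>(i, c)\<in>B k. (D j (price I i c j) - \<theta> j) * x' i c j)
        + (\<Sum>\<tau>=1..T. (D j (level I \<tau>) - \<theta> j) * y' j \<tau>))
      = L x' y' - (\<Sum>j\<in>V. \<theta> j * load k x' y' j)" for x' y'
    unfolding L_def sum_stage_H[OF k] sum_subtractf[symmetric]
    by (rule sum.cong[OF refl])
      (simp add: D_def load_def left_diff_distrib sum_subtractf sum_distrib_left distrib_left case_prod_beta)
  have "(\<Sum>j\<in>V. \<theta> j * load k x y j) = (\<Sum>j\<in>V. \<theta> j)"
    using slack by (intro sum.cong) (auto simp: algebra_simps)
  then have le: "L x' y' - (\<Sum>j\<in>V. \<theta> j * load k x' y' j) \<le> L x y - (\<Sum>j\<in>V. \<theta> j * load k x y j)"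
    if "relaxed k \<eta> x' y' z'" for x' y' z'
    using lag[OF that] by (simp add: right_diff_distrib sum_subtractf)
  show thesis
  proof (rule that)
    show "load k x y j = 1" if "j \<in> V" "0 < \<theta> j" for j using slack[OF that(1)] that(2) by simp
  qed (use \<theta> le in \<open>unfold R, auto\<close>)
qed

text \<open>Since entries may be dropped freely, truncating the reduced values
  \<open>D - \<theta>\<close> at 0 does not raise their maximum over \<open>relaxed\<close>.
  Equality then holds termwise: nothing is allocated at a negative reduced value, and the whole
  state is retained at a positive one. The slopes of the truncated values between consecutive levels
  are the residuals \<open>a\<close>.\<close>

lemma stage_residual_values:
  assumes k: "k \<in> {1..K}" and opt: "stage_optimal K I k \<eta> x y z"
  obtains a where
    "\<And>j \<tau>. j \<in> V \<Longrightarrow> \<tau> \<in> {1..T} \<Longrightarrow> 0 \<le> a j \<tau> \<and> a j \<tau> \<le> 1 - reg_slope K k (stage_H I k x y j \<tau>)"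
    "\<And>j \<tau>. j \<in> V \<Longrightarrow> \<tau> \<in> {1..T} \<Longrightarrow> stage_H I k x y j \<tau> < 1 \<Longrightarrow>
      a j \<tau> = 1 - reg_slope K k (stage_H I k x y j \<tau>)
      \<and> (\<Sum>\<tau>'=\<tau>..T. \<eta> j \<tau>') \<le> stage_H I k x y j \<tau>"
    "\<And>x' z'. relaxed k \<eta> x' \<eta> z' \<Longrightarrow>
      (\<Sum>j\<in>V. \<Sum>\<tau>=1..T. gap \<tau> * (a j \<tau> * (stage_H I k x' \<eta> j \<tau> - stage_H I k x y j \<tau>))) \<le> 0"
proof -
  let ?h = "stage_H I k x y"
  have p: "relaxed k \<eta> x y z" and load1: "\<And>j. j \<in> V \<Longrightarrow> load k x y j \<le> 1"
    using opt by (auto simp: stage_optimal_def stage_feasible_iff)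
  have h01: "0 \<le> ?h j \<tau>" "?h j \<tau> \<le> 1" if "j \<in> V" "\<tau> \<in> {1..T}" for j \<tau>
    using stage_H_bounds[OF k p that] load1[OF that(1)] by auto
  have \<eta>0: "0 \<le> \<eta> j \<tau>" if "j \<in> V" "\<tau> \<in> {1..T}" for j \<tau>
    using p that unfolding relaxed_def by (meson order.trans)
  have p\<eta>: "relaxed k \<eta> x \<eta> z" using p \<eta>0 by (simp add: relaxed_def)
  define e where "e j \<tau> = gap \<tau> * (1 - reg_slope K k (?h j \<tau>))" for j \<tau>
  define D where "D j = cum (e j)" for j
  obtain \<theta> where \<theta>: "\<And>j. j \<in> V \<Longrightarrow> 0 \<le> \<theta> j"
    and tight: "\<And>j. j \<in> V \<Longrightarrow> 0 < \<theta> j \<Longrightarrow> load k x y j = 1"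
    and max': "\<And>x' y' z'. relaxed k \<eta> x' y' z' \<Longrightarrow>
      (\<Sum>j\<in>V. (\<Sum>(i, c)\<in>B k. (D j (price I i c j) - \<theta> j) * x' i c j)
        + (\<Sum>\<tau>=1..T. (D j (level I \<tau>) - \<theta> j) * y' j \<tau>))
      \<le> (\<Sum>j\<in>V. (\<Sum>(i, c)\<in>B k. (D j (price I i c j) - \<theta> j) * x i c j)
        + (\<Sum>\<tau>=1..T. (D j (level I \<tau>) - \<theta> j) * y j \<tau>))"
    using stage_multipliers[OF k opt] unfolding D_def e_def by blast
  define R where "R x' y' j = (\<Sum>(i, c)\<in>B k. (D j (price I i c j) - \<theta> j) * x' i c j)
      + (\<Sum>\<tau>=1..T. (D j (level I \<tau>) - \<theta> j) * y' j \<tau>)" for x' y' j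
  define Q where "Q x' y' j = (\<Sum>(i, c)\<in>B k. max (D j (price I i c j) - \<theta> j) 0 * x' i c j)
      + (\<Sum>\<tau>=1..T. max (D j (level I \<tau>) - \<theta> j) 0 * y' j \<tau>)" for x' y' j
  \<comment> \<open>Free disposal: dropping all entries of negative reduced value stays in
    \<open>relaxed\<close>, and the \<open>R\<close> of what remains is the \<open>Q\<close> of the
    whole.\<close>
  have Q_max: "(\<Sum>j\<in>V. Q x' y' j) \<le> (\<Sum>j\<in>V. R x y j)" if r: "relaxed k \<eta> x' y' z'" for x' y' z'
  proof -
    let ?x = "\<lambda>i c j. if \<theta> j \<le> D j (price I i c j) then x' i c j else 0"
    let ?y = "\<lambda>j \<tau>. if \<theta> j \<le> D j (level I \<tau>) then y' j \<tau> else 0"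
    have "0 \<le> imps I i c j * z' i c" if "i \<in> batch I k" "c \<in> configs I" "j \<in> V" for i c j
      using r that unfolding relaxed_def by (meson order.trans)
    then have "relaxed k \<eta> ?x ?y z'"
      using r \<eta>0 by (auto simp: relaxed_def)
    from max'[OF this] have "(\<Sum>j\<in>V. R ?x ?y j) \<le> (\<Sum>j\<in>V. R x y j)" unfolding R_def .
    moreover have "R ?x ?y j = Q x' y' j" for j
      unfolding R_def Q_def by (intro arg_cong2[of _ _ _ _ "(+)"] sum.cong) (auto simp: max_def)
    ultimately show ?thesis by simp
  qed
  have term_x: "(D j (price I i c j) - \<theta> j) * x i c j \<le> max (D j (price I i c j) - \<theta> j) 0 * x i c j"
    if "i \<in> batch I k" "c \<in> configs I" "j \<in> V" for i c j
    using p that by (intro mult_right_mono) (auto simp: relaxed_def)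
  have term_y: "(D j (level I \<tau>) - \<theta> j) * y j \<tau> \<le> max (D j (level I \<tau>) - \<theta> j) 0 * y j \<tau>"
    if "j \<in> V" "\<tau> \<in> {1..T}" for j \<tau>
    using p that by (auto simp: relaxed_def intro!: mult_right_mono)
  have term_\<eta>: "(D j (level I \<tau>) - \<theta> j) * y j \<tau> \<le> max (D j (level I \<tau>) - \<theta> j) 0 * \<eta> j \<tau>"
    if "j \<in> V" "\<tau> \<in> {1..T}" for j \<tau>
    by (rule order_trans[OF term_y[OF that]])
      (use p that in \<open>auto simp: relaxed_def intro!: mult_left_mono\<close>)
  have sum_x: "(\<Sum>(i, c)\<in>B k. (D j (price I i c j) - \<theta> j) * x i c j)
      \<le> (\<Sum>(i, c)\<in>B k. max (D j (price I i c j) - \<theta> j) 0 * x i c j)" if "j \<in> V" for j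
    using term_x that by (intro sum_mono) auto
  have sum_y: "(\<Sum>\<tau>=1..T. (D j (level I \<tau>) - \<theta> j) * y j \<tau>)
      \<le> (\<Sum>\<tau>=1..T. max (D j (level I \<tau>) - \<theta> j) 0 * \<eta> j \<tau>)" if "j \<in> V" for j
    using term_\<eta>[OF that] by (rule sum_mono)
  have R_le_Q: "R x y j \<le> Q x y j" if "j \<in> V" for j
    unfolding R_def Q_def using term_y[OF that] by (intro add_mono sum_x that sum_mono) auto
  have R_le: "R x y j \<le> Q x \<eta> j" if "j \<in> V" for j
    unfolding R_def Q_def by (intro add_mono sum_x sum_y that)
  \<comment> \<open>Retaining the whole state beside \<open>x\<close> may exceed the capacities but
    stays in \<open>relaxed\<close>, so \<open>Q_max\<close> supplies the inequality opposite to
    \<open>R_le\<close>.\<close>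
  have R_eq: "R x y j = Q x \<eta> j" if "j \<in> V" for j
  proof (rule sum_mono_inv[OF _ R_le that finite_V])
    show "(\<Sum>j\<in>V. R x y j) = (\<Sum>j\<in>V. Q x \<eta> j)"
      using Q_max[OF p\<eta>] sum_mono[of V, OF R_le] by (intro antisym) auto
  qed
  \<comment> \<open>Equal sums of termwise ordered values have equal terms; where the truncation
    changes the coefficient, the variable must vanish.\<close>
  have x0: "x i c j = 0" if "i \<in> batch I k" "c \<in> configs I" "j \<in> V" "D j (price I i c j) < \<theta> j" for i c j
  proof -
    have eq: "(\<Sum>ic\<in>B k. case ic of (i, c) \<Rightarrow> (D j (price I i c j) - \<theta> j) * x i c j)
        = (\<Sum>ic\<in>B k. case ic of (i, c) \<Rightarrow> max (D j (price I i c j) - \<theta> j) 0 * x i c j)"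
      using R_eq[OF that(3)] sum_x[OF that(3)] sum_y[OF that(3)] unfolding R_def Q_def by linarith
    have "(case (i, c) of (i, c) \<Rightarrow> (D j (price I i c j) - \<theta> j) * x i c j)
        = (case (i, c) of (i, c) \<Rightarrow> max (D j (price I i c j) - \<theta> j) 0 * x i c j)"
      using that by (intro sum_mono_inv[OF eq _ _ finite_B[OF k]]) (auto intro: term_x)
    then show ?thesis using that(4) by auto
  qed
  have y_eq: "(D j (level I \<tau>) - \<theta> j) * y j \<tau> = max (D j (level I \<tau>) - \<theta> j) 0 * \<eta> j \<tau>"
    if "j \<in> V" "\<tau> \<in> {1..T}" for j \<tau>
  proof -
    have eq: "(\<Sum>\<tau>=1..T. (D j (level I \<tau>) - \<theta> j) * y j \<tau>)
        = (\<Sum>\<tau>=1..T. max (D j (level I \<tau>) - \<theta> j) 0 * \<eta> j \<tau>)"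
      using R_eq[OF that(1)] sum_x[OF that(1)] sum_y[OF that(1)] unfolding R_def Q_def by linarith
    show ?thesis
      using term_\<eta>[OF that(1)] that(2) by (intro sum_mono_inv[OF eq]) auto
  qed
  have e_nonneg: "0 \<le> e j \<tau>" if "j \<in> V" "\<tau> \<in> {1..T}" for j \<tau>
    using gap_pos[OF that(2)] reg_slope_bounds(2)[OF h01[OF that], of K k] by (simp add: e_def)
  have D_mono: "D j q \<le> D j r" if "j \<in> V" "q \<le> r" for j q r
    unfolding D_def using e_nonneg that by (intro cum_mono)
  have D_0: "D j (level I 0) = 0" for j unfolding D_def by (subst cum_level) auto
  have D_step: "D j (level I \<tau>) = D j (level I (\<tau> - 1)) + e j \<tau>" if "\<tau> \<in> {1..T}" for j \<tau>
    using that unfolding D_def by (cases \<tau>) (auto simp: cum_level)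
  define a where "a j \<tau> =
    (max (D j (level I \<tau>) - \<theta> j) 0 - max (D j (level I (\<tau> - 1)) - \<theta> j) 0) / gap \<tau>" for j \<tau>
  have gap_a: "gap \<tau> * a j \<tau> = max (D j (level I \<tau>) - \<theta> j) 0 - max (D j (level I (\<tau> - 1)) - \<theta> j) 0"
    if "\<tau> \<in> {1..T}" for j \<tau>
    using gap_pos[OF that] by (simp add: a_def)
  \<comment> \<open>The telescoping starts at level 0, where \<open>D\<close> is 0 and
    \<open>0 \<le> \<theta> j\<close> makes the truncated value 0.\<close>
  have cum_a: "cum (\<lambda>\<tau>. gap \<tau> * a j \<tau>) (level I t) = max (D j (level I t) - \<theta> j) 0"
    if j: "j \<in> V" and t: "t \<le> T" for j t
  proof -
    have "(\<Sum>\<tau>=1..t. gap \<tau> * a j \<tau>) = max (D j (level I t) - \<theta> j) 0" using t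
    proof (induction t)
      case 0
      then show ?case using \<theta>[OF j] by (simp add: D_0)
    next
      case (Suc t)
      then show ?case using gap_a[of "Suc t" j] by simp
    qed
    then show ?thesis using t by (simp add: cum_level)
  qed
  have Q_eq: "(\<Sum>\<tau>=1..T. gap \<tau> * a j \<tau> * stage_H I k x' y' j \<tau>) = Q x' y' j" if j: "j \<in> V" for x' y' j
  proof -
    have "cum (\<lambda>\<tau>. gap \<tau> * a j \<tau>) (price I i c j) = max (D j (price I i c j) - \<theta> j) 0"
      if ic: "i \<in> batch I k" "c \<in> configs I" for i c
    proof -
      obtain t where t: "t \<le> T" "price I i c j = level I t" using priceE[OF k ic j] .
      show ?thesis unfolding t(2) by (rule cum_a[OF j t(1)])
    qed
    then show ?thesis
      unfolding sum_stage_H[OF k] Q_def using j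
      by (intro arg_cong2[of _ _ _ _ "(+)"] sum.cong) (auto simp: cum_a)
  qed
  \<comment> \<open>A positive \<open>\<theta> j\<close> means full capacity, so \<open>H < 1\<close> leaves some mass below level \<open>\<tau>\<close>; that mass
    was worth keeping.\<close>
  have D_ge: "\<theta> j \<le> D j (level I (\<tau> - 1))"
    if j: "j \<in> V" and \<tau>: "\<tau> \<in> {1..T}" and lt: "?h j \<tau> < 1" for j \<tau>
  proof (rule ccontr)
    assume "\<not> ?thesis"
    then have less: "D j (level I (\<tau> - 1)) < \<theta> j" by simp
    have "level I 0 \<le> level I (\<tau> - 1)" using \<tau> by (subst level_le_iff) auto
    then have "0 \<le> D j (level I (\<tau> - 1))" using D_mono[OF j] D_0[of j] by metis
    then have "load k x y j = 1" using less tight[OF j] by simp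
    moreover have "load k x y j = ?h j \<tau>"
      unfolding load_def stage_H_def
    proof (intro arg_cong2[of _ _ _ _ "(+)"] sum.mono_neutral_right finite_B k ballI)
      fix ic assume ic: "ic \<in> B k - {(i, c). i \<in> batch I k \<and> c \<in> configs I \<and> level I \<tau> \<le> price I i c j}"
      obtain i c where [simp]: "ic = (i, c)" by (cases ic)
      have ic': "i \<in> batch I k" "c \<in> configs I" "price I i c j < level I \<tau>" using ic by auto
      obtain t where t: "t \<le> T" "price I i c j = level I t" using priceE[OF k ic'(1,2) j] .
      then have "t \<le> \<tau> - 1" using ic'(3) level_le_iff[of \<tau> t] \<tau> by (auto simp: not_le[symmetric])
      then have "price I i c j \<le> level I (\<tau> - 1)" using t \<tau> level_le_iff[of t "\<tau> - 1"] by auto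
      then have "D j (price I i c j) < \<theta> j" using D_mono[OF j] less by (meson le_less_trans)
      then show "(case ic of (i, c) \<Rightarrow> x i c j) = 0" using x0 ic' j by simp
    next
      fix t assume t: "t \<in> {1..T} - {\<tau>..T}"
      then have "level I t \<le> level I (\<tau> - 1)" using \<tau> by (subst level_le_iff) auto
      then have "D j (level I t) < \<theta> j" using D_mono[OF j] less by (meson le_less_trans)
      then show "y j t = 0" using y_eq[OF j, of t] t by auto
    qed (use \<tau> in auto)
    ultimately show False using lt by simp
  qed
  show thesis
  proof (rule that)
    fix j \<tau> assume j: "j \<in> V" and \<tau>: "\<tau> \<in> {1..T}"
    \<comment> \<open>Truncation is monotone and does not enlarge increments.\<close>
    have "0 \<le> gap \<tau> * a j \<tau> \<and> gap \<tau> * a j \<tau> \<le> e j \<tau>"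
      using gap_a[OF \<tau>, of j] D_step[OF \<tau>, of j] e_nonneg[OF j \<tau>] by auto
    then show "0 \<le> a j \<tau> \<and> a j \<tau> \<le> 1 - reg_slope K k (?h j \<tau>)"
      using gap_pos[OF \<tau>] by (auto simp: e_def zero_le_mult_iff)
    assume lt: "?h j \<tau> < 1"
    have "gap \<tau> * a j \<tau> = e j \<tau>"
      using gap_a[OF \<tau>, of j] D_step[OF \<tau>, of j] e_nonneg[OF j \<tau>] D_ge[OF j \<tau> lt] by simp
    then have "a j \<tau> = 1 - reg_slope K k (?h j \<tau>)" using gap_pos[OF \<tau>] by (simp add: e_def)
    moreover have "(\<Sum>t=\<tau>..T. \<eta> j t) \<le> ?h j \<tau>"
    proof -
      \<comment> \<open>The strict increment lifts \<open>D\<close> above \<open>\<theta> j\<close>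
        at level \<open>\<tau>\<close> and hence at all higher levels, so everything carried over
        there is retained and \<open>stage_H\<close> cannot fall below it.\<close>
      have "0 < e j \<tau>"
        using gap_pos[OF \<tau>] reg_slope_less_one[OF h01(1)[OF j \<tau>] lt] by (simp add: e_def)
      then have "\<theta> j < D j (level I \<tau>)" using D_step[OF \<tau>, of j] D_ge[OF j \<tau> lt] by simp
      moreover have "D j (level I \<tau>) \<le> D j (level I t)" if "t \<in> {\<tau>..T}" for t
        using that \<tau> by (intro D_mono[OF j]) (simp add: level_le_iff)
      ultimately have "\<theta> j < D j (level I t)" if "t \<in> {\<tau>..T}" for t
        using that by (meson less_le_trans)
      then have "y j t = \<eta> j t" if "t \<in> {\<tau>..T}" for t
        using y_eq[OF j, of t] that \<tau> by fastforce
      then have "(\<Sum>t=\<tau>..T. \<eta> j t) = (\<Sum>t=\<tau>..T. y j t)" by simp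
      moreover have "0 \<le> (\<Sum>(i, c)\<in>{(i, c). i \<in> batch I k \<and> c \<in> configs I \<and> level I \<tau> \<le> price I i c j}. x i c j)"
        using p j by (intro sum_nonneg) (auto simp: relaxed_def)
      ultimately show ?thesis unfolding stage_H_def by simp
    qed
    ultimately show "a j \<tau> = 1 - reg_slope K k (?h j \<tau>) \<and> (\<Sum>t=\<tau>..T. \<eta> j t) \<le> ?h j \<tau>" ..
  next
    fix x' z' assume "relaxed k \<eta> x' \<eta> z'"
    from Q_max[OF this] have "(\<Sum>j\<in>V. Q x' \<eta> j) \<le> (\<Sum>j\<in>V. R x y j)" .
    also have "\<dots> \<le> (\<Sum>j\<in>V. Q x y j)" by (intro sum_mono R_le_Q)
    finally have "(\<Sum>j\<in>V. \<Sum>\<tau>=1..T. gap \<tau> * a j \<tau> * stage_H I k x' \<eta> j \<tau>)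
        \<le> (\<Sum>j\<in>V. \<Sum>\<tau>=1..T. gap \<tau> * a j \<tau> * ?h j \<tau>)"
      by (simp only: Q_eq cong: sum.cong)
    then show "(\<Sum>j\<in>V. \<Sum>\<tau>=1..T. gap \<tau> * (a j \<tau> * (stage_H I k x' \<eta> j \<tau> - ?h j \<tau>))) \<le> 0"
      by (simp add: right_diff_distrib sum_subtractf mult.assoc)
  qed
qed

section \<open>Comparison with the offline optimum\<close>

lemma sum_users: "(\<Sum>i\<in>users K I. f i) = (\<Sum>k=1..K. \<Sum>i\<in>batch I k. f i)"
  unfolding users_def
  by (rule sum.UNION_disjoint) (use inst in \<open>auto simp: mca_instance_def disjoint_family_on_def\<close>)

text \<open>Every price of at least \<open>level I \<tau>\<close> equals exactly one level from
  \<open>\<tau>\<close> to \<open>T\<close>, so the level sets partition the counted pairs. This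
  turns \<open>stage_H\<close> into a tail sum of the new state, the form in which it enters the
  next stage.\<close>

lemma stage_H_state:
  assumes k: "k \<in> {1..K}" and j: "j \<in> V" and \<tau>: "\<tau> \<in> {1..T}"
    and \<eta>: "\<And>t. t \<in> {1..T} \<Longrightarrow> \<eta> j t =
      (\<Sum>(i, c)\<in>{(i, c). i \<in> batch I k \<and> c \<in> configs I \<and> price I i c j = level I t}. x i c j) + y j t"
  shows "stage_H I k x y j \<tau> = (\<Sum>t=\<tau>..T. \<eta> j t)"
proof -
  let ?E = "\<lambda>t. {(i, c). i \<in> batch I k \<and> c \<in> configs I \<and> price I i c j = level I t}"
  have un: "{(i, c). i \<in> batch I k \<and> c \<in> configs I \<and> price I i c j \<ge> level I \<tau>} = (\<Union>t\<in>{\<tau>..T}. ?E t)"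
  proof (intro equalityI subsetI)
    fix ic assume "ic \<in> {(i, c). i \<in> batch I k \<and> c \<in> configs I \<and> price I i c j \<ge> level I \<tau>}"
    then obtain i c where ic: "ic = (i, c)" "i \<in> batch I k" "c \<in> configs I" "price I i c j \<ge> level I \<tau>"
      by auto
    obtain t where "t \<le> T" "price I i c j = level I t" using priceE[OF k ic(2,3) j] .
    then show "ic \<in> (\<Union>t\<in>{\<tau>..T}. ?E t)" using ic \<tau> level_le_iff[of \<tau> t] by auto
  qed (use \<tau> in \<open>auto simp: level_le_iff\<close>)
  have "(\<Sum>(i, c)\<in>(\<Union>t\<in>{\<tau>..T}. ?E t). x i c j) = (\<Sum>t=\<tau>..T. \<Sum>(i, c)\<in>?E t. x i c j)"
  proof (rule sum.UNION_disjoint)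
    show "\<forall>t\<in>{\<tau>..T}. finite (?E t)"
      by (intro ballI finite_subset[OF _ finite_B[OF k]]) auto
    have "level I s \<noteq> level I t" if "s \<in> {\<tau>..T}" "t \<in> {\<tau>..T}" "s \<noteq> t" for s t
      using that level_le_iff[of s t] level_le_iff[of t s] by auto
    then show "\<forall>s\<in>{\<tau>..T}. \<forall>t\<in>{\<tau>..T}. s \<noteq> t \<longrightarrow> ?E s \<inter> ?E t = {}" by fastforce
  qed simp
  then show ?thesis unfolding stage_H_def un using \<eta> \<tau> by (simp add: sum.distrib)
qed

text \<open>The offline allocation of a batch together with the full previous state may exceed the
  capacities; it is a valid test point because the residual values are bounded over
  \<open>relaxed\<close> and not merely over feasible solutions.\<close>

lemma offline_value_le_revenue:
  assumes K: "K \<ge> 1" and run: "pr_mca_run K I x y z \<eta>" and off: "offline_feasible K I X Z"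
  shows "Gamma_ratio K * offline_value K I X \<le> revenue K I \<eta>"
proof -
  \<comment> \<open>Tail sums of the state agree with \<open>stage_H\<close> in every stage and also
    make sense at index 0, where they vanish.\<close>
  define h where "h k j \<tau> = (\<Sum>t=\<tau>..T. \<eta> k j t)" for k j \<tau>
  have opt: "stage_optimal K I k (\<eta> (k - 1)) (x k) (y k) (z k)" if "k \<in> {1..K}" for k
    using run that by (simp add: pr_mca_run_def)
  have feas: "relaxed k (\<eta> (k - 1)) (x k) (y k) (z k)" "\<And>j. j \<in> V \<Longrightarrow> load k (x k) (y k) j \<le> 1"
    if "k \<in> {1..K}" for k
    using opt[OF that] by (auto simp: stage_optimal_def stage_feasible_iff)
  have h_eq: "stage_H I k (x k) (y k) j \<tau> = h k j \<tau>"
    if "k \<in> {1..K}" "j \<in> V" "\<tau> \<in> {1..T}" for k j \<tau>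
    unfolding h_def using that run by (intro stage_H_state) (auto simp: pr_mca_run_def)
  have h_bounds: "0 \<le> h k j \<tau>" "h k j \<tau> \<le> 1" if "k \<in> {1..K}" "j \<in> V" "\<tau> \<in> {1..T}" for k j \<tau>
    using stage_H_bounds[OF that(1) feas(1)[OF that(1)] that(2,3)] feas(2)[OF that(1,2)]
    unfolding h_eq[OF that] by auto
  have h_0: "h 0 j \<tau> = 0" if "j \<in> V" "\<tau> \<in> {1..T}" for j \<tau>
    using run that by (auto simp: h_def pr_mca_run_def intro!: sum.neutral)

  define m where "m k j \<tau> = stage_H I k X (\<lambda>_ _. 0) j \<tau>" for k j \<tau>
  have X_relaxed: "relaxed k \<eta>' X \<eta>' Z"
    if "k \<in> {1..K}" "\<And>j \<tau>. j \<in> V \<Longrightarrow> \<tau> \<in> {1..T} \<Longrightarrow> 0 \<le> \<eta>' j \<tau>" for k \<eta>'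
  proof -
    have "i \<in> users K I" if "i \<in> batch I k" for i using \<open>k \<in> {1..K}\<close> that by (auto simp: users_def)
    then show ?thesis using off that by (auto simp: relaxed_def offline_feasible_def)
  qed
  have m_nonneg: "0 \<le> m k j \<tau>" and m_le: "m k j \<tau> \<le> (\<Sum>i\<in>batch I k. \<Sum>c\<in>configs I. X i c j)"
    if "k \<in> {1..K}" "j \<in> V" "\<tau> \<in> {1..T}" for k j \<tau>
    using stage_H_bounds[OF that(1) X_relaxed[OF that(1), of "\<lambda>_ _. 0"] that(2,3)]
    by (auto simp: m_def load_def sum.cartesian_product)
  have m_sum: "(\<Sum>k=1..K. m k j \<tau>) \<le> 1" if "j \<in> V" "\<tau> \<in> {1..T}" for j \<tau>
  proof -
    have "(\<Sum>k=1..K. m k j \<tau>) \<le> (\<Sum>k=1..K. \<Sum>i\<in>batch I k. \<Sum>c\<in>configs I. X i c j)"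
      using that by (intro sum_mono m_le)
    also have "\<dots> \<le> 1"
      unfolding sum_users[symmetric] using off that by (simp add: offline_feasible_def)
    finally show ?thesis .
  qed
  have m_eq: "stage_H I k X (\<eta> (k - 1)) j \<tau> = m k j \<tau> + h (k - 1) j \<tau>" for k j \<tau>
    by (simp add: m_def h_def stage_H_def)

  have "\<forall>k\<in>{1..K}. \<exists>a. (\<forall>j\<in>V. \<forall>\<tau>\<in>{1..T}. 0 \<le> a j \<tau> \<and> a j \<tau> \<le> 1 - reg_slope K k (h k j \<tau>)
        \<and> (h k j \<tau> < 1 \<longrightarrow> a j \<tau> = 1 - reg_slope K k (h k j \<tau>) \<and> h (k - 1) j \<tau> \<le> h k j \<tau>))
      \<and> (\<Sum>j\<in>V. \<Sum>\<tau>=1..T. gap \<tau> * (a j \<tau> * (m k j \<tau> + h (k - 1) j \<tau> - h k j \<tau>))) \<le> 0"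
  proof
    fix k assume k: "k \<in> {1..K}"
    have "0 \<le> \<eta> (k - 1) j \<tau>" if "j \<in> V" "\<tau> \<in> {1..T}" for j \<tau>
      using feas(1)[OF k] that unfolding relaxed_def by (meson order.trans)
    then have XZ: "relaxed k (\<eta> (k - 1)) X (\<eta> (k - 1)) Z" by (intro X_relaxed k)
    obtain a where a: "\<And>j \<tau>. j \<in> V \<Longrightarrow> \<tau> \<in> {1..T} \<Longrightarrow>
        0 \<le> a j \<tau> \<and> a j \<tau> \<le> 1 - reg_slope K k (stage_H I k (x k) (y k) j \<tau>)"
      "\<And>j \<tau>. j \<in> V \<Longrightarrow> \<tau> \<in> {1..T} \<Longrightarrow> stage_H I k (x k) (y k) j \<tau> < 1 \<Longrightarrow>
        a j \<tau> = 1 - reg_slope K k (stage_H I k (x k) (y k) j \<tau>)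
        \<and> (\<Sum>t=\<tau>..T. \<eta> (k - 1) j t) \<le> stage_H I k (x k) (y k) j \<tau>"
      "\<And>X' Z'. relaxed k (\<eta> (k - 1)) X' (\<eta> (k - 1)) Z' \<Longrightarrow>
        (\<Sum>j\<in>V. \<Sum>\<tau>=1..T. gap \<tau> * (a j \<tau> * (stage_H I k X' (\<eta> (k - 1)) j \<tau>
          - stage_H I k (x k) (y k) j \<tau>))) \<le> 0"
      using stage_residual_values[OF k opt[OF k]] by blast
    have "(\<Sum>j\<in>V. \<Sum>\<tau>=1..T. gap \<tau> * (a j \<tau> * (m k j \<tau> + h (k - 1) j \<tau> - h k j \<tau>))) \<le> 0"
      using a(3)[OF XZ] by (simp only: m_eq h_eq[OF k] cong: sum.cong)
    then show "\<exists>a. (\<forall>j\<in>V. \<forall>\<tau>\<in>{1..T}. 0 \<le> a j \<tau> \<and> a j \<tau> \<le> 1 - reg_slope K k (h k j \<tau>)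
        \<and> (h k j \<tau> < 1 \<longrightarrow> a j \<tau> = 1 - reg_slope K k (h k j \<tau>) \<and> h (k - 1) j \<tau> \<le> h k j \<tau>))
      \<and> (\<Sum>j\<in>V. \<Sum>\<tau>=1..T. gap \<tau> * (a j \<tau> * (m k j \<tau> + h (k - 1) j \<tau> - h k j \<tau>))) \<le> 0"
      using a(1,2) by (intro exI[of _ a]) (simp add: h_eq[OF k] h_def[of "k - Suc 0"])
  qed
  then obtain a where a: "\<And>k j \<tau>. k \<in> {1..K} \<Longrightarrow> j \<in> V \<Longrightarrow> \<tau> \<in> {1..T} \<Longrightarrow>
        0 \<le> a k j \<tau> \<and> a k j \<tau> \<le> 1 - reg_slope K k (h k j \<tau>)"
      "\<And>k j \<tau>. k \<in> {1..K} \<Longrightarrow> j \<in> V \<Longrightarrow> \<tau> \<in> {1..T} \<Longrightarrow> h k j \<tau> < 1 \<Longrightarrow>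
        a k j \<tau> = 1 - reg_slope K k (h k j \<tau>) \<and> h (k - 1) j \<tau> \<le> h k j \<tau>"
    and stage: "\<And>k. k \<in> {1..K} \<Longrightarrow>
        (\<Sum>j\<in>V. \<Sum>\<tau>=1..T. gap \<tau> * (a k j \<tau> * (m k j \<tau> + h (k - 1) j \<tau> - h k j \<tau>))) \<le> 0"
    unfolding bchoice_iff by blast

  have "Gamma_ratio K * (\<Sum>k=1..K. m k j \<tau>)
      \<le> h K j \<tau> + (\<Sum>k=1..K. a k j \<tau> * (m k j \<tau> + h (k - 1) j \<tau> - h k j \<tau>))"
    if j: "j \<in> V" and \<tau>: "\<tau> \<in> {1..T}" for j \<tau>
  proof (rule stagewise_charging[OF K])
    fix k assume k: "k \<in> {1..K}"
    \<comment> \<open>The residual values give monotonicity only where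
      \<open>h k j \<tau> < 1\<close>; otherwise \<open>h k j \<tau>\<close> is 1 and this bound
      gives it.\<close>
    have "h (k - 1) j \<tau> \<le> 1"
    proof (cases "k = 1")
      case False
      then have "k - 1 \<in> {1..K}" using k by auto
      then show ?thesis using h_bounds(2) j \<tau> by blast
    qed (simp add: h_0[OF j \<tau>])
    then have "h (k - 1) j \<tau> \<le> h k j \<tau>" using a(2)[OF k j \<tau>] by linarith
    then show "0 \<le> h k j \<tau> \<and> h k j \<tau> \<le> 1 \<and> h (k - 1) j \<tau> \<le> h k j \<tau>"
      using h_bounds[OF k j \<tau>] by simp
  qed (use a h_0 m_nonneg m_sum j \<tau> in auto)
  then have "(\<Sum>j\<in>V. \<Sum>\<tau>=1..T. gap \<tau> * (Gamma_ratio K * (\<Sum>k=1..K. m k j \<tau>)))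
      \<le> (\<Sum>j\<in>V. \<Sum>\<tau>=1..T. gap \<tau> * (h K j \<tau>
        + (\<Sum>k=1..K. a k j \<tau> * (m k j \<tau> + h (k - 1) j \<tau> - h k j \<tau>))))"
    by (intro sum_mono mult_left_mono less_imp_le[OF gap_pos])
  also have "\<dots> = (\<Sum>j\<in>V. \<Sum>\<tau>=1..T. gap \<tau> * h K j \<tau>)
      + (\<Sum>j\<in>V. \<Sum>\<tau>=1..T. \<Sum>k=1..K. gap \<tau> * (a k j \<tau> * (m k j \<tau> + h (k - 1) j \<tau> - h k j \<tau>)))"
    by (simp only: distrib_left sum.distrib sum_distrib_left)
  \<comment> \<open>The stage inequality holds only after summation over advertisers and levels, so
    the sum over stages has to be moved outermost.\<close>
  also have "(\<Sum>j\<in>V. \<Sum>\<tau>=1..T. \<Sum>k=1..K. gap \<tau> * (a k j \<tau> * (m k j \<tau> + h (k - 1) j \<tau> - h k j \<tau>)))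
      = (\<Sum>j\<in>V. \<Sum>k=1..K. \<Sum>\<tau>=1..T. gap \<tau> * (a k j \<tau> * (m k j \<tau> + h (k - 1) j \<tau> - h k j \<tau>)))"
    by (rule sum.cong[OF refl sum.swap])
  also have "\<dots> = (\<Sum>k=1..K. \<Sum>j\<in>V. \<Sum>\<tau>=1..T.
        gap \<tau> * (a k j \<tau> * (m k j \<tau> + h (k - 1) j \<tau> - h k j \<tau>)))"
    by (rule sum.swap)
  also have "\<dots> \<le> 0" using stage by (rule sum_nonpos)
  also have "(\<Sum>j\<in>V. \<Sum>\<tau>=1..T. gap \<tau> * h K j \<tau>) = revenue K I \<eta>"
    unfolding revenue_def
  proof (rule sum.cong[OF refl])
    \<comment> \<open>With no new allocation and \<open>\<eta> K\<close> retained,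
      \<open>stage_H\<close> is \<open>h K\<close>, so summation by parts returns the state weighted
      by the levels.\<close>
    fix j assume "j \<in> V"
    then show "(\<Sum>\<tau>=1..T. gap \<tau> * h K j \<tau>) = (\<Sum>\<tau>=1..T. level I \<tau> * \<eta> K j \<tau>)"
      using sum_gap_stage_H[of K j "\<lambda>_ _ _. 0" "\<eta> K"] K by (simp add: stage_H_def h_def)
  qed
  also have "(\<Sum>j\<in>V. \<Sum>\<tau>=1..T. gap \<tau> * (Gamma_ratio K * (\<Sum>k=1..K. m k j \<tau>)))
      = Gamma_ratio K * offline_value K I X"
  proof -
    have "(\<Sum>\<tau>=1..T. gap \<tau> * (\<Sum>k=1..K. m k j \<tau>)) =
        (\<Sum>i\<in>users K I. \<Sum>c\<in>configs I. price I i c j * X i c j)" if "j \<in> V" for j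
    proof -
      have "(\<Sum>\<tau>=1..T. gap \<tau> * (\<Sum>k=1..K. m k j \<tau>)) = (\<Sum>k=1..K. \<Sum>\<tau>=1..T. gap \<tau> * m k j \<tau>)"
        unfolding sum_distrib_left by (rule sum.swap)
      also have "\<dots> = (\<Sum>k=1..K. \<Sum>i\<in>batch I k. \<Sum>c\<in>configs I. price I i c j * X i c j)"
        unfolding m_def using that
        by (intro sum.cong refl, subst sum_gap_stage_H) (simp_all add: sum.cartesian_product)
      finally show ?thesis by (simp only: sum_users)
    qed
    moreover have "offline_value K I X = (\<Sum>j\<in>V. \<Sum>i\<in>users K I. \<Sum>c\<in>configs I. price I i c j * X i c j)"
    proof -
      have "offline_value K I X = (\<Sum>i\<in>users K I. \<Sum>j\<in>V. \<Sum>c\<in>configs I. price I i c j * X i c j)"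
        unfolding offline_value_def by (rule sum.cong[OF refl sum.swap])
      also have "\<dots> = (\<Sum>j\<in>V. \<Sum>i\<in>users K I. \<Sum>c\<in>configs I. price I i c j * X i c j)"
        by (rule sum.swap)
      finally show ?thesis .
    qed
    ultimately show ?thesis
      by (simp add: mult.left_commute[of _ "Gamma_ratio K"] flip: sum_distrib_left)
  qed
  finally show ?thesis by simp
qed

end

theorem theorem2:
  fixes K :: nat
    and I :: "('u, 'c, 'v) mca"
    and x :: "nat \<Rightarrow> 'u \<Rightarrow> 'c \<Rightarrow> 'v \<Rightarrow> real"
    and y :: "nat \<Rightarrow> 'v \<Rightarrow> nat \<Rightarrow> real"
    and z :: "nat \<Rightarrow> 'u \<Rightarrow> 'c \<Rightarrow> real"
    and \<eta> :: "nat \<Rightarrow> 'v \<Rightarrow> nat \<Rightarrow> real"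
  assumes "K \<ge> 1"
    and "mca_instance K I"
    and "pr_mca_run K I x y z \<eta>"
  shows "revenue K I \<eta> \<ge> Gamma_ratio K * offline_opt K I"
proof -
  interpret mca_stages K I using assms(2) by unfold_locales
  \<comment> \<open>Dividing by the positive ratio gives one upper bound for all offline values, and
    hence for their supremum.\<close>
  have "offline_opt K I \<le> revenue K I \<eta> / Gamma_ratio K"
    unfolding offline_opt_def
  proof (rule cSup_least[OF offline_values_nonempty[OF assms(2)]])
    fix v assume "v \<in> {offline_value K I x |x z. offline_feasible K I x z}"
    then show "v \<le> revenue K I \<eta> / Gamma_ratio K"
      using offline_value_le_revenue[OF assms(1,3)] Gamma_ratio_pos[OF assms(1)]
      by (auto simp: pos_le_divide_eq mult.commute)
  qed
  then show ?thesis using Gamma_ratio_pos[OF assms(1)] by (simp add: pos_le_divide_eq mult.commute)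
qed

end
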